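(* Let $\Phi$ be a Young function, let $w\in A_{i_\Phi}$, and let $\varphi_1,\varphi_2$ be positive measurable functions on $\mathbb{R}^n\times(0,\infty)$ such that $\varphi_1\in\mathcal{G}^{\Phi}_w$ and, for some constant $C>0$, $$\varphi_1(x,r)\le C\,\varphi_2(x,r)\qquad\text{for all }x\in\mathbb{R}^n,\ r>0.$$ Let $T$ be a genuine Calderón–Zygmund (singular integral) operator. If $T$ is bounded from $M^{\Phi,\varphi_1}_w(\mathbb{R}^n)$ to $WM^{\Phi,\varphi_2}_w(\mathbb{R}^n)$, then there is a constant $C>0$ such that $$\int_r^\infty \varphi_1(x,t)\,\frac{dt}{t}\le C\,\varphi_2(x,r)\qquad\text{for all }x\in\mathbb{R}^n,\ r>0.$$
   Context: A Young function is a convex, left-continuous $\Phi:[0,\infty)\to[0,\infty]$ with $\lim_{r\to0^+}\Phi(r)=\Phi(0)=0$ and $\lim_{r\to\infty}\Phi(r)=\infty$. Put $\Phi^{-1}(s)=\inf\{r\ge0:\Phi(r)>s\}$ ($\inf\emptyset=\infty$). With $h_\Phi(t)=\sup_{s>0}\Phi(st)/\Phi(s)$, the lower dilation index is $i_\Phi=\lim_{t\to0^+}\frac{\log h_\Phi(t)}{\log t}$. Weights: for $1<p<\infty$, a locally integrable $w:\mathbb{R}^n\to[0,\infty)$ (not a.e. zero) is in $A_p$ if $\sup_B\big(\frac1{|B|}\int_Bw\big)\big(\frac1{|B|}\int_Bw^{-p'/p}\big)^{p/p'}<\infty$, supremum over all balls; $w\in A_1$ if, for some $C>0$, $\frac1{|B|}\int_Bw\le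 Cw(x)$ for a.e. $x\in B$, for every ball $B$; $A_\infty=\bigcup_{p\ge1}A_p$. $w(E)=\int_Ew\,dx$. Spaces: $\|f\|_{L^\Phi_w}=\inf\{\lambda>0:\int_{\mathbb{R}^n}\Phi(|f|/\lambda)w\,dx\le1\}$ and $\|f\|_{WL^\Phi_w}=\inf\{\lambda>0:\sup_{t>0}\Phi(t)\,w(\{x:|f(x)|/\lambda>t\})\le1\}$. For a ball $B$, $\|f\|_{L^\Phi_w(B)}=\|f\chi_B\|_{L^\Phi_w}$ and $\|f\|_{WL^\Phi_w(B)}=\|f\chi_B\|_{WL^\Phi_w}$; the local spaces $L^{\Phi,\mathrm{loc}}_w$, $WL^{\Phi,\mathrm{loc}}_w$ consist of measurable $f$ for which these are finite for every ball. For a positive measurable $\varphi$ on $\mathbb{R}^n\times(0,\infty)$, $M^{\Phi,\varphi}_w(\mathbb{R}^n)$ is the set of $f\in L^{\Phi,\mathrm{loc}}_w$ with $\|f\|_{M^{\Phi,\varphi}_w}=\sup_{x\in\mathbb{R}^n,r>0}\varphi(x,r)^{-1}\Phi^{-1}\big(w(B(x,r))^{-1}\big)\|f\|_{L^\Phi_w(B(x,r))}<\infty$, and $WM^{\Phi,\varphi}_w(\mathbb{R}^n)$ is the set of $f\in WL^{\Phi,\mathrm{loc}}_w$ with $\|f\|_{WM^{\Phi,\varphi}_w}=\sup_{x\in\mathbb{R}^n,r>0}\varphi(x,r)^{-1}\Phi^{-1}\big(w(B(x,r))^{-1}\big)\|f\|_{WL^\Phi_w(B(x,r))}<\infty$.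 Class $\mathcal{G}^\Phi_w$: writing $\varphi(B)=\varphi(x,r)$ and $r_B=r$ for $B=B(x,r)$, it consists of all $\varphi:\mathbb{R}^n\times(0,\infty)\to(0,\infty)$ for which there is $C>0$ such that for all balls $B,B_0$: $\varphi(B_0)\le C\varphi(B)$ if $r_B\le r_{B_0}$, and $\frac{\varphi(B_0)}{\Phi^{-1}(w(B_0)^{-1})}\le C\frac{\varphi(B)}{\Phi^{-1}(w(B)^{-1})}$ if $r_B\ge r_{B_0}$. Calderón–Zygmund operator: a bounded linear operator $T$ on $L^2(\mathbb{R}^n)$ for which there is a function $K$ on $\mathbb{R}^n\times\mathbb{R}^n$ such that (i) $|K(x,y)|\le C|x-y|^{-n}$ for $x\ne y$; (ii) for some $\varepsilon>0$, $C>0$, $|K(x,y)-K(z,y)|+|K(y,x)-K(y,z)|\le C\frac{|x-z|^\varepsilon}{|x-y|^{n+\varepsilon}}$ whenever $|x-y|\ge2|x-z|$, $x\ne y$; (iii) for bounded compactly supported $f$, $Tf(x)=\int_{\mathbb{R}^n}K(x,y)f(y)\,dy$ for all $x\notin\operatorname{supp}f$. It is genuine if there are $C>0$ and a cone $V=R\{x=(x',x_n)\in\mathbb{R}^n:|x'|<\theta|x_n|\}$ with $\theta>0$ and $R$ an orthogonal matrix, such that $K(x,y)\ge\frac{C}{|x-y|^n}$ for all $x,y$ with $x-y\in V$. Meaning of $Tf$ on these spaces: for a ball $B$ (with $2B$ the concentric ball of twice the radius) and a.e. $x\in B$, $Tf(x)=T(f\chi_{2B})(x)+\int_{\mathbb{R}^n\setminus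 2B}K(x,y)f(y)\,dy$, where $f\chi_{2B}$ is integrable (since $w\in A_{i_\Phi}$) and $T(f\chi_{2B})$ is understood via the extension of $T$ from bounded compactly supported functions given by its weak type $(1,1)$ estimate (this coincides with the continuous extension of $T$ to $L^\Phi_w$ whenever the latter exists). $Tf$ is well defined if the integral converges absolutely for a.e. $x\in B$ for every ball $B$, and the functions obtained from two balls agree a.e. on their intersection. "$T$ is bounded from $X$ to $Y$" means that for every $f\in X$, $Tf$ is well defined in this sense, lies in $Y$, and $\|Tf\|_Y\le C\|f\|_X$ with $C$ independent of $f$. *)

theory Defs
  imports "HOL-Analysis.Analysis"
begin

section \<open>Young functions\<close>

(* A Young function lives on [0,\<infinity>); it is modelled by a total function on real whose values on
   negative arguments are never inspected. *)
definition young_function :: "(real \<Rightarrow> ennreal) \<Rightarrow> bool" where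
  "young_function \<Phi> \<longleftrightarrow>
     (\<forall>a\<ge>0. \<forall>b\<ge>0. \<forall>u\<in>{0..1}.
        \<Phi> ((1 - u) * a + u * b) \<le> ennreal (1 - u) * \<Phi> a + ennreal u * \<Phi> b) \<and>
     (\<forall>r>0. continuous (at_left r) \<Phi>) \<and>
     \<Phi> 0 = 0 \<and> (\<Phi> \<longlongrightarrow> 0) (at_right 0) \<and> (\<Phi> \<longlongrightarrow> \<infinity>) at_top"

definition young_inv :: "(real \<Rightarrow> ennreal) \<Rightarrow> ennreal \<Rightarrow> ennreal" where
  "young_inv \<Phi> s = Inf (ennreal ` {r. 0 \<le> r \<and> s < \<Phi> r})"

(* In ennreal, 0/0 = \<infinity>/\<infinity> = 0 and c/0 = \<infinity> for c > 0, so indeterminate quotients do not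
   contribute to the supremum; the supremum is the infimum of the constants C > 0 for which
   \<Phi>(s t) \<le> C \<Phi>(s) holds for all s > 0. *)
definition dilation_fun :: "(real \<Rightarrow> ennreal) \<Rightarrow> real \<Rightarrow> ennreal" where
  "dilation_fun \<Phi> t = (SUP s\<in>{0<..}. \<Phi> (s * t) / \<Phi> s)"

definition ln_ennreal :: "ennreal \<Rightarrow> ereal" where
  "ln_ennreal a = (if a = 0 then -\<infinity> else if a = \<infinity> then \<infinity> else ereal (ln (enn2real a)))"

(* Extended-real valued: the index is \<infinity> for instance when \<Phi> takes only the values 0 and \<infinity>. *)
definition lower_index :: "(real \<Rightarrow> ennreal) \<Rightarrow> ereal" where
  "lower_index \<Phi> = Lim (at_right 0) (\<lambda>t. ln_ennreal (dilation_fun \<Phi> t) / ereal (ln t))"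


section \<open>Muckenhoupt weights\<close>

definition ennreal_powr :: "ennreal \<Rightarrow> real \<Rightarrow> ennreal" where
  "ennreal_powr a q =
     (if a = 0 \<and> q < 0 then \<infinity>
      else if a = \<infinity> then (if q < 0 then 0 else \<infinity>)
      else ennreal (enn2real a powr q))"

definition weight :: "(real^'n \<Rightarrow> real) \<Rightarrow> bool" where
  "weight w \<longleftrightarrow> (\<forall>x. 0 \<le> w x) \<and> (\<forall>a r. set_integrable lebesgue (ball a r) w) \<and>
     \<not> (AE x in lebesgue. w x = 0)"

definition average :: "(real^'n) set \<Rightarrow> (real^'n \<Rightarrow> ennreal) \<Rightarrow> ennreal" where
  "average B f = (\<integral>\<^sup>+x\<in>B. f x \<partial>lebesgue) / emeasure lebesgue B"

definition A_one :: "(real^'n \<Rightarrow> real) set" where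
  "A_one = {w. weight w \<and>
     (\<exists>C>0. \<forall>a. \<forall>r>0. AE x in lebesgue. x \<in> ball a r \<longrightarrow>
        average (ball a r) (\<lambda>y. ennreal (w y)) \<le> ennreal (C * w x))}"

(* p / (p - 1) is the conjugate exponent p'. *)
definition A_gt_one :: "real \<Rightarrow> (real^'n \<Rightarrow> real) set" where
  "A_gt_one p = {w. weight w \<and>
     (let p' = p / (p - 1) in
      (SUP (a, r)\<in>UNIV \<times> {0<..}.
         average (ball a r) (\<lambda>x. ennreal (w x)) *
         ennreal_powr (average (ball a r) (\<lambda>x. ennreal_powr (ennreal (w x)) (- (p' / p)))) (p / p'))
      < \<infinity>)}"

definition A_real :: "real \<Rightarrow> (real^'n \<Rightarrow> real) set" where
  "A_real p = (if p = 1 then A_one else A_gt_one p)"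

(* Only 1 \<le> p \<le> \<infinity> is meaningful. *)
definition Muckenhoupt_A :: "ereal \<Rightarrow> (real^'n \<Rightarrow> real) set" where
  "Muckenhoupt_A p =
     (if p = \<infinity> then (\<Union>q\<in>{1..}. A_real q) else if 1 \<le> p then A_real (real_of_ereal p) else {})"

definition wmeas :: "(real^'n \<Rightarrow> real) \<Rightarrow> (real^'n) set \<Rightarrow> ennreal" where
  "wmeas w E = (\<integral>\<^sup>+x\<in>E. ennreal (w x) \<partial>lebesgue)"


section \<open>Weighted Orlicz and Orlicz--Morrey spaces\<close>

(* Scalars: the sort {real_normed_field, euclidean_space} has exactly the real and the complex
   numbers as models (Gelfand--Mazur), so both scalar fields are covered. *)

definition restr :: "(real^'n) set \<Rightarrow> (real^'n \<Rightarrow> 'a) \<Rightarrow> real^'n \<Rightarrow> 'a::{real_normed_field,euclidean_space}"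
  where "restr A f = (\<lambda>x. indicator A x *\<^sub>R f x)"

definition orlicz_norm ::
  "(real \<Rightarrow> ennreal) \<Rightarrow> (real^'n \<Rightarrow> real) \<Rightarrow> (real^'n \<Rightarrow> 'a::{real_normed_field,euclidean_space}) \<Rightarrow> ennreal"
  where
  "orlicz_norm \<Phi> w f =
     Inf (ennreal ` {l. 0 < l \<and> (\<integral>\<^sup>+x. \<Phi> (norm (f x) / l) * ennreal (w x) \<partial>lebesgue) \<le> 1})"

definition weak_orlicz_norm ::
  "(real \<Rightarrow> ennreal) \<Rightarrow> (real^'n \<Rightarrow> real) \<Rightarrow> (real^'n \<Rightarrow> 'a::{real_normed_field,euclidean_space}) \<Rightarrow> ennreal"
  where
  "weak_orlicz_norm \<Phi> w f =
     Inf (ennreal ` {l. 0 < l \<and> (SUP t\<in>{0<..}. \<Phi> t * wmeas w {x. t < norm (f x) / l}) \<le> 1})"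

definition orlicz_loc ::
  "(real \<Rightarrow> ennreal) \<Rightarrow> (real^'n \<Rightarrow> real) \<Rightarrow> (real^'n \<Rightarrow> 'a::{real_normed_field,euclidean_space}) set"
  where
  "orlicz_loc \<Phi> w = {f. f \<in> borel_measurable lebesgue \<and>
     (\<forall>a. \<forall>r>0. orlicz_norm \<Phi> w (restr (ball a r) f) < \<infinity>)}"

definition weak_orlicz_loc ::
  "(real \<Rightarrow> ennreal) \<Rightarrow> (real^'n \<Rightarrow> real) \<Rightarrow> (real^'n \<Rightarrow> 'a::{real_normed_field,euclidean_space}) set"
  where
  "weak_orlicz_loc \<Phi> w = {f. f \<in> borel_measurable lebesgue \<and>
     (\<forall>a. \<forall>r>0. weak_orlicz_norm \<Phi> w (restr (ball a r) f) < \<infinity>)}"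

definition morrey_norm ::
  "(real \<Rightarrow> ennreal) \<Rightarrow> (real^'n \<Rightarrow> real \<Rightarrow> real) \<Rightarrow> (real^'n \<Rightarrow> real) \<Rightarrow>
   (real^'n \<Rightarrow> 'a::{real_normed_field,euclidean_space}) \<Rightarrow> ennreal" where
  "morrey_norm \<Phi> \<phi> w f = (SUP (a, r)\<in>UNIV \<times> {0<..}.
     inverse (ennreal (\<phi> a r)) * young_inv \<Phi> (inverse (wmeas w (ball a r))) *
     orlicz_norm \<Phi> w (restr (ball a r) f))"

definition weak_morrey_norm ::
  "(real \<Rightarrow> ennreal) \<Rightarrow> (real^'n \<Rightarrow> real \<Rightarrow> real) \<Rightarrow> (real^'n \<Rightarrow> real) \<Rightarrow>
   (real^'n \<Rightarrow> 'a::{real_normed_field,euclidean_space}) \<Rightarrow> ennreal" where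
  "weak_morrey_norm \<Phi> \<phi> w f = (SUP (a, r)\<in>UNIV \<times> {0<..}.
     inverse (ennreal (\<phi> a r)) * young_inv \<Phi> (inverse (wmeas w (ball a r))) *
     weak_orlicz_norm \<Phi> w (restr (ball a r) f))"

definition morrey_space ::
  "(real \<Rightarrow> ennreal) \<Rightarrow> (real^'n \<Rightarrow> real \<Rightarrow> real) \<Rightarrow> (real^'n \<Rightarrow> real) \<Rightarrow>
   (real^'n \<Rightarrow> 'a::{real_normed_field,euclidean_space}) set" where
  "morrey_space \<Phi> \<phi> w = {f \<in> orlicz_loc \<Phi> w. morrey_norm \<Phi> \<phi> w f < \<infinity>}"

definition weak_morrey_space ::
  "(real \<Rightarrow> ennreal) \<Rightarrow> (real^'n \<Rightarrow> real \<Rightarrow> real) \<Rightarrow> (real^'n \<Rightarrow> real) \<Rightarrow>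
   (real^'n \<Rightarrow> 'a::{real_normed_field,euclidean_space}) set" where
  "weak_morrey_space \<Phi> \<phi> w = {f \<in> weak_orlicz_loc \<Phi> w. weak_morrey_norm \<Phi> \<phi> w f < \<infinity>}"

(* Joint Lebesgue measurability. A section \<phi>(x,\<cdot>) need not be measurable for exceptional x; a
   nonnegative integral of such a section is Isabelle's lower integral. *)
definition positive_measurable :: "(real^'n \<Rightarrow> real \<Rightarrow> real) \<Rightarrow> bool" where
  "positive_measurable \<phi> \<longleftrightarrow> (\<forall>x. \<forall>r>0. 0 < \<phi> x r) \<and>
     (\<lambda>(x, r). \<phi> x r) \<in> borel_measurable (lebesgue_on (UNIV \<times> {0<..}))"

definition G_class ::
  "(real \<Rightarrow> ennreal) \<Rightarrow> (real^'n \<Rightarrow> real) \<Rightarrow> (real^'n \<Rightarrow> real \<Rightarrow> real) set" where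
  "G_class \<Phi> w = {\<phi>. (\<forall>x. \<forall>r>0. 0 < \<phi> x r) \<and>
     (\<exists>C>0. \<forall>a r a0 r0. 0 < r \<longrightarrow> 0 < r0 \<longrightarrow>
        (r \<le> r0 \<longrightarrow> \<phi> a0 r0 \<le> C * \<phi> a r) \<and>
        (r0 \<le> r \<longrightarrow>
           ennreal (\<phi> a0 r0) / young_inv \<Phi> (inverse (wmeas w (ball a0 r0))) \<le>
           ennreal C * (ennreal (\<phi> a r) / young_inv \<Phi> (inverse (wmeas w (ball a r))))))}"


section \<open>Calderon--Zygmund operators\<close>

definition L2_space :: "(real^'n \<Rightarrow> 'a::{real_normed_field,euclidean_space}) set" where
  "L2_space = {f. f \<in> borel_measurable lebesgue \<and> integrable lebesgue (\<lambda>x. (norm (f x))\<^sup>2)}"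

definition L2_norm_fun :: "(real^'n \<Rightarrow> 'a::{real_normed_field,euclidean_space}) \<Rightarrow> real" where
  "L2_norm_fun f = sqrt (\<integral>x. (norm (f x))\<^sup>2 \<partial>lebesgue)"

(* Operators act on representatives. Linearity and the norm bound together force T to respect
   a.e. equality on L^2; values of T outside L^2 are never used. *)
definition bounded_linear_L2 ::
  "((real^'n \<Rightarrow> 'a) \<Rightarrow> real^'n \<Rightarrow> 'a::{real_normed_field,euclidean_space}) \<Rightarrow> bool" where
  "bounded_linear_L2 T \<longleftrightarrow>
     (\<forall>f\<in>L2_space. T f \<in> L2_space) \<and>
     (\<forall>f\<in>L2_space. \<forall>g\<in>L2_space. AE x in lebesgue. T (\<lambda>y. f y + g y) x = T f x + T g x) \<and>
     (\<forall>c. \<forall>f\<in>L2_space. AE x in lebesgue. T (\<lambda>y. c * f y) x = c * T f x) \<and>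
     (\<exists>C. \<forall>f\<in>L2_space. L2_norm_fun (T f) \<le> C * L2_norm_fun f)"

definition supp :: "(real^'n \<Rightarrow> 'a::{real_normed_field,euclidean_space}) \<Rightarrow> (real^'n) set" where
  "supp f = closure {x. f x \<noteq> 0}"

definition bounded_cpt :: "(real^'n \<Rightarrow> 'a::{real_normed_field,euclidean_space}) set" where
  "bounded_cpt = {f. f \<in> borel_measurable lebesgue \<and> bounded (range f) \<and> compact (supp f)}"

(* As T f is an element of L^2, the kernel representation off the support is an identity a.e. *)
definition calderon_zygmund ::
  "((real^'n \<Rightarrow> 'a) \<Rightarrow> real^'n \<Rightarrow> 'a::{real_normed_field,euclidean_space}) \<Rightarrow>
   (real^'n \<Rightarrow> real^'n \<Rightarrow> 'a) \<Rightarrow> bool" where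
  "calderon_zygmund T K \<longleftrightarrow>
     bounded_linear_L2 T \<and>
     (\<exists>C. \<forall>x y. x \<noteq> y \<longrightarrow> norm (K x y) \<le> C / norm (x - y) ^ CARD('n)) \<and>
     (\<exists>\<epsilon>>0. \<exists>C>0. \<forall>x y z. 2 * norm (x - z) \<le> norm (x - y) \<longrightarrow> x \<noteq> y \<longrightarrow>
        norm (K x y - K z y) + norm (K y x - K y z) \<le>
        C * (norm (x - z) powr \<epsilon> / norm (x - y) powr (real CARD('n) + \<epsilon>))) \<and>
     (\<forall>f\<in>bounded_cpt. AE x in lebesgue. x \<notin> supp f \<longrightarrow> T f x = (\<integral>y. K x y * f y \<partial>lebesgue))"

(* The index type carries no order, so the axis k plays the role of the last coordinate x_n;
   since the cone is rotated by an arbitrary orthogonal matrix, the choice of k is immaterial. *)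
definition cone_about :: "'n \<Rightarrow> real \<Rightarrow> (real^'n) set" where
  "cone_about k \<theta> = {x. sqrt (\<Sum>i\<in>UNIV - {k}. (x $ i)\<^sup>2) < \<theta> * \<bar>x $ k\<bar>}"

(* An inequality K(x,y) \<ge> c between a scalar and a real number includes that K(x,y) is real. *)
definition genuine_kernel ::
  "(real^'n \<Rightarrow> real^'n \<Rightarrow> 'a::{real_normed_field,euclidean_space}) \<Rightarrow> bool" where
  "genuine_kernel K \<longleftrightarrow>
     (\<exists>C>0. \<exists>\<theta>>0. \<exists>R::real^'n^'n. \<exists>k. orthogonal_matrix R \<and>
        (\<forall>x y. x - y \<in> (\<lambda>v. R *v v) ` cone_about k \<theta> \<longrightarrow>
           (\<exists>c. K x y = of_real c \<and> C / norm (x - y) ^ CARD('n) \<le> c)))"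

definition weak_L1_norm :: "(real^'n \<Rightarrow> 'a::{real_normed_field,euclidean_space}) \<Rightarrow> ennreal" where
  "weak_L1_norm f = (SUP t\<in>{0<..}. ennreal t * emeasure lebesgue {x. t < norm (f x)})"

(* h is the value at g of the extension of T to L^1 by continuity from L^1 into weak L^1,
   starting from bounded compactly supported functions (which are dense in L^1, so that h is
   unique a.e.; it exists by the weak type (1,1) estimate). *)
definition weak11_value ::
  "((real^'n \<Rightarrow> 'a) \<Rightarrow> real^'n \<Rightarrow> 'a) \<Rightarrow> (real^'n \<Rightarrow> 'a) \<Rightarrow>
   (real^'n \<Rightarrow> 'a::{real_normed_field,euclidean_space}) \<Rightarrow> bool" where
  "weak11_value T g h \<longleftrightarrow>
     integrable lebesgue g \<and> h \<in> borel_measurable lebesgue \<and>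
     (\<forall>u. (\<forall>k::nat. u k \<in> bounded_cpt) \<longrightarrow>
        (\<lambda>k. \<integral>x. norm (u k x - g x) \<partial>lebesgue) \<longlonglongrightarrow> 0 \<longrightarrow>
        (\<lambda>k. weak_L1_norm (\<lambda>x. T (u k) x - h x)) \<longlonglongrightarrow> 0)"

(* Tf is well defined and equals g a.e. A single g that represents Tf on every ball exists iff
   the functions obtained on the individual balls exist and agree a.e. on overlaps. *)
definition CZ_value ::
  "((real^'n \<Rightarrow> 'a) \<Rightarrow> real^'n \<Rightarrow> 'a) \<Rightarrow> (real^'n \<Rightarrow> real^'n \<Rightarrow> 'a) \<Rightarrow> (real^'n \<Rightarrow> 'a) \<Rightarrow>
   (real^'n \<Rightarrow> 'a::{real_normed_field,euclidean_space}) \<Rightarrow> bool" where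
  "CZ_value T K f g \<longleftrightarrow>
     (\<forall>a. \<forall>r>0. \<exists>h. weak11_value T (restr (ball a (2 * r)) f) h \<and>
        (AE x in lebesgue. x \<in> ball a r \<longrightarrow>
           set_integrable lebesgue (- ball a (2 * r)) (\<lambda>y. K x y * f y) \<and>
           g x = h x + set_lebesgue_integral lebesgue (- ball a (2 * r)) (\<lambda>y. K x y * f y)))"

definition CZ_bounded_morrey ::
  "((real^'n \<Rightarrow> 'a) \<Rightarrow> real^'n \<Rightarrow> 'a::{real_normed_field,euclidean_space}) \<Rightarrow>
   (real^'n \<Rightarrow> real^'n \<Rightarrow> 'a) \<Rightarrow> (real \<Rightarrow> ennreal) \<Rightarrow> (real^'n \<Rightarrow> real) \<Rightarrow>
   (real^'n \<Rightarrow> real \<Rightarrow> real) \<Rightarrow> (real^'n \<Rightarrow> real \<Rightarrow> real) \<Rightarrow> bool" where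
  "CZ_bounded_morrey T K \<Phi> w \<phi>1 \<phi>2 \<longleftrightarrow>
     (\<exists>C>0. \<forall>f\<in>morrey_space \<Phi> \<phi>1 w. \<exists>g\<in>weak_morrey_space \<Phi> \<phi>2 w.
        CZ_value T K f g \<and> weak_morrey_norm \<Phi> \<phi>2 w g \<le> ennreal C * morrey_norm \<Phi> \<phi>1 w f)"

end

theory Submission
  imports Defs
begin

text \<open>
  Up to constants, \<open>\<phi>1\<close> is a decreasing function \<open>\<psi>\<close> of the radius alone. The obvious test function
  \<open>\<psi> \<bar>y - x\<bar>\<close>, restricted to \<open>\<bar>y - x\<bar> > r\<close> and to the cone where the kernel is positive, makes \<open>T f\<close> at least
  of the order of the integral of \<open>\<psi> t / t\<close> over \<open>t > r\<close> on a small ball around \<open>x\<close>, but its Morrey norm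
  need not be bounded: already for \<open>\<Phi> t = t\<^sup>p\<close> and \<open>\<psi> t = t powr (- n / p)\<close> it picks up a logarithm.
  One therefore keeps only some dyadic layers. If \<open>e\<close> further layers have height at least half of that of the
  layer \<open>k\<close>, then the reverse doubling of \<open>w\<close> makes the layer \<open>k\<close> contribute at most \<open>O(\<sigma> ^ e)\<close> to the Orlicz
  modular, \<open>\<sigma> < 1\<close>. Keeping at most \<open>e + 1\<close> layers for every value of \<open>e\<close> bounds the modular by
  the sum of \<open>(e + 1) * \<sigma> ^ e\<close>, while it costs only a factor of two in the sum of the heights.
\<close>

subsection \<open>Young functions\<close>

text \<open>The decay \<open>\<sigma> ^ e\<close> has this source: the growth condition in
  \<open>G_class\<close> controls the modular of a whole ball filled at the height of layer
  \<open>k + e\<close>. Layer \<open>k\<close> is at most twice as high, but its ball carries at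
  most the fraction \<open>\<sigma> ^ e\<close> of the weight. Two extremes show what the selection
  does. If the heights halve within boundedly many steps, \<open>e\<close> is bounded and boundedly
  many layers survive, yet they dominate a geometric sum. If all heights agree, \<open>e\<close>
  takes each value once and every layer survives. A Morrey norm tests balls of every centre and
  radius \<open>R\<close>, so a run of comparable layers may be cut off by \<open>R\<close>; this
  costs a second geometric series. Each test function has finitely many layers, with bounds
  independent of their number, so convergence of the integral is part of the conclusion. The
  operator bounds the values of \<open>\<psi>\<close> at radii from \<open>2 * r\<close> on by
  \<open>\<phi>2\<close> at the smaller radius \<open>\<delta> * r\<close>; the gap between these
  radii is bridged by the assumed domination of \<open>\<phi>1\<close> by
  \<open>\<phi>2\<close>.\<close>

lemma young_scale:
  assumes "young_function \<Phi>" "0 \<le> \<theta>" "\<theta> \<le> 1" "0 \<le> a"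
  shows "\<Phi> (\<theta> * a) \<le> ennreal \<theta> * \<Phi> a"
proof -
  have "\<Phi> ((1 - \<theta>) * 0 + \<theta> * a) \<le> ennreal (1 - \<theta>) * \<Phi> 0 + ennreal \<theta> * \<Phi> a"
    using assms unfolding young_function_def by (metis atLeastAtMost_iff order_refl)
  then show ?thesis
    using assms(1) by (simp add: young_function_def)
qed

text \<open>Monotonicity comes from convexity together with \<open>\<Phi> 0 = 0\<close>, by scaling
  \<open>b\<close> down to \<open>a\<close>.\<close>

lemma young_mono:
  assumes "young_function \<Phi>" "0 \<le> a" "a \<le> b"
  shows "\<Phi> a \<le> \<Phi> b"
proof (cases "b = 0")
  case False
  then have "\<Phi> (a / b * b) \<le> ennreal (a / b) * \<Phi> b"
    using assms by (intro young_scale) auto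
  also have "\<dots> \<le> 1 * \<Phi> b"
    using assms False by (intro mult_right_mono) auto
  finally show ?thesis
    using False by simp
qed (use assms in auto)

lemma young_inv_le:
  assumes "0 \<le> r" "s < \<Phi> r"
  shows "young_inv \<Phi> s \<le> ennreal r"
  unfolding young_inv_def using assms by (intro INF_lower) auto

lemma young_inv_pos:
  assumes \<Phi>: "young_function \<Phi>" and "0 < s"
  shows "0 < young_inv \<Phi> s"
proof -
  have "eventually (\<lambda>r. \<Phi> r < s) (at_right 0)"
    using \<Phi> \<open>0 < s\<close> unfolding young_function_def by (metis order_tendstoD(2))
  then obtain d where d: "d > 0" "\<And>r. 0 < r \<Longrightarrow> r < d \<Longrightarrow> \<Phi> r < s"
    unfolding eventually_at_right_field by auto
  have "ennreal d \<le> young_inv \<Phi> s"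
    unfolding young_inv_def
  proof (rule INF_greatest)
    fix r assume "r \<in> {r. 0 \<le> r \<and> s < \<Phi> r}"
    then have "0 \<le> r" "s < \<Phi> r" by auto
    moreover have "r \<noteq> 0"
      using \<Phi> \<open>s < \<Phi> r\<close> by (auto simp: young_function_def)
    ultimately show "ennreal d \<le> ennreal r"
      using d(2)[of r] by (intro ennreal_leI) (rule leI, use \<open>0 \<le> r\<close> \<open>s < \<Phi> r\<close> in auto)
  qed
  with d(1) show ?thesis
    by (metis ennreal_less_zero_iff order_less_le_trans)
qed

lemma young_inv_finite:
  assumes \<Phi>: "young_function \<Phi>" and "s < \<infinity>"
  shows "young_inv \<Phi> s < \<infinity>"
proof -
  have "(\<Phi> \<longlongrightarrow> \<infinity>) at_top"
    using \<Phi> by (simp add: young_function_def)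
  then have "eventually (\<lambda>r. s < \<Phi> r) at_top"
    using \<open>s < \<infinity>\<close> by (metis order_tendstoD(1))
  then have "eventually (\<lambda>r. s < \<Phi> r \<and> 0 \<le> r) at_top"
    using eventually_ge_at_top[of "0::real"] by eventually_elim auto
  then obtain r where "s < \<Phi> r" "0 \<le> r"
    using eventually_happens'[OF trivial_limit_at_top_linorder] by blast
  then show ?thesis
    using young_inv_le by (metis ennreal_less_top infinity_ennreal_def order_le_less_trans)
qed

text \<open>Strictly below the generalised inverse, \<open>\<Phi>\<close> stays at most
  \<open>s\<close>; left continuity carries this bound to the endpoint, where \<open>\<Phi>\<close>
  may jump to the right.\<close>

lemma young_at_inv_le:
  assumes \<Phi>: "young_function \<Phi>" and s: "0 < s" "s < \<infinity>"
  shows "\<Phi> (enn2real (young_inv \<Phi> s)) \<le> s"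
proof -
  define u where "u = enn2real (young_inv \<Phi> s)"
  have u: "ennreal u = young_inv \<Phi> s"
    using young_inv_finite[OF \<Phi> s(2)] by (simp add: u_def)
  have "u > 0"
    using young_inv_pos[OF \<Phi> s(1)] u by (metis ennreal_less_zero_iff)
  have "(\<Phi> \<longlongrightarrow> \<Phi> u) (at_left u)"
    using \<Phi> \<open>u > 0\<close> by (simp add: young_function_def continuous_within)
  moreover have "eventually (\<lambda>r. \<Phi> r \<le> s) (at_left u)"
    unfolding eventually_at_left_field
  proof (intro exI[of _ 0] conjI allI impI \<open>u > 0\<close>)
    fix r assume r: "0 < r" "r < u"
    show "\<Phi> r \<le> s"
    proof (rule ccontr)
      assume "\<not> \<Phi> r \<le> s"
      then have "ennreal u \<le> ennreal r"
        unfolding u using r by (intro young_inv_le) auto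
      then show False
        using r by simp
    qed
  qed
  ultimately have "\<Phi> u \<le> s"
    by (intro tendsto_upperbound[of \<Phi> "\<Phi> u" "at_left u"]) auto
  then show ?thesis
    by (simp add: u_def)
qed

lemma young_gt_of_inv_less:
  assumes \<Phi>: "young_function \<Phi>" and "young_inv \<Phi> s < ennreal r"
  shows "s < \<Phi> r"
proof -
  obtain t where t: "0 \<le> t" "s < \<Phi> t" "ennreal t < ennreal r"
    using assms(2) unfolding young_inv_def by (auto simp: Inf_less_iff)
  then have "t \<le> r"
    by (metis ennreal_less_iff less_imp_le)
  then show ?thesis
    using young_mono[OF \<Phi> t(1)] t(2) by (meson order_less_le_trans)
qed

subsection \<open>Selection of layers\<close>

text \<open>\<open>J\<close> consists of the \<open>d\<close> smallest elements of \<open>S\<close>.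
  Entries \<open>d\<close> places apart in the increasing enumeration differ by at least
  \<open>d\<close>, so the terms after the first \<open>d\<close> are at most half of the terms
  \<open>d\<close> places earlier. The tail is thus at most half of the whole sum.\<close>

lemma sum_le_double_initial_sum:
  fixes \<alpha> :: "nat \<Rightarrow> real"
  assumes "finite S" and \<alpha>: "\<And>k. k \<in> S \<Longrightarrow> 0 \<le> \<alpha> k"
    and gap: "\<And>k l. k \<in> S \<Longrightarrow> l \<in> S \<Longrightarrow> k + d \<le> l \<Longrightarrow> 2 * \<alpha> l \<le> \<alpha> k"
  shows "\<exists>J\<subseteq>S. card J \<le> d \<and> (\<Sum>k\<in>S. \<alpha> k) \<le> 2 * (\<Sum>k\<in>J. \<alpha> k)"
proof (cases "card S \<le> d")
  case True
  then show ?thesis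
    using sum_nonneg[of S \<alpha>] \<alpha> by (intro exI[of _ S]) auto
next
  case False
  define n where "n = card S"
  define xs where "xs = sorted_list_of_set S"
  have xs: "set xs = S" "distinct xs" "length xs = n" "sorted_wrt (<) xs"
    using \<open>finite S\<close> by (simp_all add: xs_def n_def)
  have nth_in: "xs ! i \<in> S" if "i < n" for i
    using that xs by auto
  have spread: "xs ! i + j \<le> xs ! (i + j)" if "i + j < n" for i j
    using that
  proof (induction j)
    case (Suc j)
    then have "xs ! (i + j) < xs ! (i + Suc j)"
      using sorted_wrt_nth_less[OF xs(4)] xs(3) by auto
    with Suc show ?case by force
  qed simp
  have inj: "inj_on ((!) xs) {..<n}"
    using xs by (auto simp: inj_on_def nth_eq_iff_index_eq)
  have img: "(!) xs ` {..<n} = S"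
    using xs by (force simp: set_conv_nth)
  define J where "J = (!) xs ` {..<d}"
  have d: "d \<le> n" using False by (simp add: n_def)
  have inj': "inj_on ((!) xs) {..<d}"
    using inj d by (auto intro: inj_on_subset)
  have eqS: "(\<Sum>k\<in>S. \<alpha> k) = (\<Sum>i<n. \<alpha> (xs ! i))"
    using sum.reindex[OF inj, of \<alpha>] img by simp
  have eqJ: "(\<Sum>k\<in>J. \<alpha> k) = (\<Sum>i<d. \<alpha> (xs ! i))"
    using sum.reindex[OF inj', of \<alpha>] J_def by simp
  have split: "(\<Sum>i<d + m. \<alpha> (xs ! i)) = (\<Sum>i<d. \<alpha> (xs ! i)) + (\<Sum>i<m. \<alpha> (xs ! (i + d)))" for m
    by (induction m) (auto simp: add.commute)
  have "(\<Sum>i<n. \<alpha> (xs ! i)) = (\<Sum>i<d. \<alpha> (xs ! i)) + (\<Sum>i<n - d. \<alpha> (xs ! (i + d)))"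
    using split[of "n - d"] d by simp
  also have "(\<Sum>i<n - d. \<alpha> (xs ! (i + d))) \<le> (\<Sum>i<n - d. \<alpha> (xs ! i) / 2)"
  proof (rule sum_mono)
    fix i assume "i \<in> {..<n - d}"
    then have i: "i + d < n" by auto
    then show "\<alpha> (xs ! (i + d)) \<le> \<alpha> (xs ! i) / 2"
      using gap[OF nth_in[of i] nth_in[OF i] spread[OF i]] by auto
  qed
  also have "\<dots> \<le> (\<Sum>i<n. \<alpha> (xs ! i) / 2)"
    using \<alpha> nth_in by (intro sum_mono2) auto
  also have "\<dots> = (\<Sum>i<n. \<alpha> (xs ! i)) / 2"
    by (simp add: sum_divide_distrib)
  finally have "(\<Sum>k\<in>S. \<alpha> k) \<le> 2 * (\<Sum>k\<in>J. \<alpha> k)"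
    by (simp add: eqS eqJ)
  moreover have "J \<subseteq> S"
    using d nth_in by (force simp: J_def)
  moreover have "card J \<le> d"
    unfolding J_def using card_image_le[of "{..<d}" "(!) xs"] by simp
  ultimately show ?thesis by blast
qed

text \<open>The number \<open>e k\<close> counts how long the sequence stays above half of its value at \<open>k\<close>. Two indices
  with the same \<open>e\<close> that are more than \<open>e\<close> apart have values differing by a factor of two, so only
  the first \<open>e + 1\<close> of them matter for the sum.\<close>

lemma sparse_selection:
  fixes \<alpha> :: "nat \<Rightarrow> real"
  assumes pos: "\<And>k. 0 \<le> \<alpha> k" and dec: "\<And>k l. k \<le> l \<Longrightarrow> \<alpha> l \<le> \<alpha> k"
  shows "\<exists>J e. J \<subseteq> {..<N} \<and> (\<Sum>k<N. \<alpha> k) \<le> 2 * (\<Sum>k\<in>J. \<alpha> k) \<and>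
    (\<forall>k\<in>J. \<forall>l. k \<le> l \<longrightarrow> l \<le> k + e k \<longrightarrow> \<alpha> k \<le> 2 * \<alpha> l) \<and>
    (\<forall>d. card {k \<in> J. e k = d} \<le> Suc d)"
proof -
  \<comment> \<open>The cut-off \<open>k + d < N\<close> makes the set finite; for
    \<open>k < N\<close> it contains 0 because \<open>\<alpha> k\<close> is nonnegative.\<close>
  define e where "e k = Max {d. k + d < N \<and> \<alpha> k \<le> 2 * \<alpha> (k + d)}" for k
  have fin: "finite {d. k + d < N \<and> \<alpha> k \<le> 2 * \<alpha> (k + d)}" for k
    by (rule finite_subset[of _ "{..<N}"]) auto
  have e_in: "k + e k < N \<and> \<alpha> k \<le> 2 * \<alpha> (k + e k)" if "k < N" for k
  proof -
    have "0 \<in> {d. k + d < N \<and> \<alpha> k \<le> 2 * \<alpha> (k + d)}"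
      using that pos[of k] by simp
    then have "e k \<in> {d. k + d < N \<and> \<alpha> k \<le> 2 * \<alpha> (k + d)}"
      unfolding e_def using fin by (intro Max_in) blast+
    then show ?thesis by simp
  qed
  have e_max: "d \<le> e k" if "k + d < N" "\<alpha> k \<le> 2 * \<alpha> (k + d)" for k d
    unfolding e_def using that fin by (intro Max_ge) auto
  define good where "good d J \<longleftrightarrow> J \<subseteq> {k. k < N \<and> e k = d} \<and> card J \<le> Suc d \<and>
    (\<Sum>k | k < N \<and> e k = d. \<alpha> k) \<le> 2 * (\<Sum>k\<in>J. \<alpha> k)" for d J
  have "\<exists>J. good d J" for d
    unfolding good_def
  proof (rule sum_le_double_initial_sum)
    fix k l assume kl: "k \<in> {k. k < N \<and> e k = d}" "l \<in> {k. k < N \<and> e k = d}" "k + Suc d \<le> l"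
    show "2 * \<alpha> l \<le> \<alpha> k"
    proof (rule ccontr)
      assume "\<not> 2 * \<alpha> l \<le> \<alpha> k"
      then have "l - k \<le> e k"
        using e_max[of k "l - k"] kl by simp
      then show False
        using kl by simp
    qed
  qed (use pos in auto)
  then obtain I where "good d (I d)" for d
    by metis
  then have I: "\<And>d. I d \<subseteq> {k. k < N \<and> e k = d}" "\<And>d. card (I d) \<le> Suc d"
    "\<And>d. (\<Sum>k | k < N \<and> e k = d. \<alpha> k) \<le> 2 * (\<Sum>k\<in>I d. \<alpha> k)"
    by (simp_all only: good_def)
  define J where "J = {k. k < N \<and> k \<in> I (e k)}"
  have J: "{k \<in> J. e k = d} = I d" for d
    using I(1)[of d] by (auto simp: J_def)
  have JN: "J \<subseteq> {..<N}" by (auto simp: J_def)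
  have finJ: "finite J" using JN finite_subset by blast
  have "e k \<le> N" if "k < N" for k
    using e_in[OF that] by simp
  then have img: "e ` {..<N} \<subseteq> {..N}" "e ` J \<subseteq> {..N}"
    using JN by auto
  have "(\<Sum>k<N. \<alpha> k) = (\<Sum>d\<le>N. \<Sum>k\<in>{k \<in> {..<N}. e k = d}. \<alpha> k)"
    by (rule sum.group[symmetric]) (use img in auto)
  also have "\<dots> \<le> (\<Sum>d\<le>N. 2 * (\<Sum>k\<in>{k \<in> J. e k = d}. \<alpha> k))"
    using I(3) by (intro sum_mono) (simp add: J)
  also have "\<dots> = 2 * (\<Sum>k\<in>J. \<alpha> k)"
    using sum.group[of J "{..N}" e \<alpha>] finJ img by (simp add: sum_distrib_left[symmetric])
  finally have "(\<Sum>k<N. \<alpha> k) \<le> 2 * (\<Sum>k\<in>J. \<alpha> k)" .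
  \<comment> \<open>The inequality is known at the end \<open>k + e k\<close> of the run;
    monotonicity gives it at every index before.\<close>
  moreover have "\<alpha> k \<le> 2 * \<alpha> l" if "k \<in> J" "k \<le> l" "l \<le> k + e k" for k l
    using e_in[of k] dec[OF that(3)] that(1) by (auto simp: J_def)
  ultimately show ?thesis
    using JN I(2) J by (intro exI[of _ J] exI[of _ e]) auto
qed

subsection \<open>Muckenhoupt weights\<close>

text \<open>\<open>weight\<close> speaks of measurability only through integrability on balls, so
  \<open>w\<close> is recovered as the pointwise limit of its restrictions to growing balls.\<close>

lemma weight_measurable:
  fixes w :: "real^'n \<Rightarrow> real"
  assumes "weight w"
  shows "w \<in> borel_measurable lebesgue"
proof (rule borel_measurable_LIMSEQ_real)
  show "(\<lambda>n. indicator (ball 0 (real n)) x *\<^sub>R w x) \<longlonglongrightarrow> w x" for x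
  proof (rule tendsto_eventually)
    obtain N :: nat where N: "norm x < real N"
      using reals_Archimedean2 by blast
    show "\<forall>\<^sub>F n in sequentially. indicator (ball 0 (real n)) x *\<^sub>R w x = w x"
      using eventually_ge_at_top[of N]
    proof eventually_elim
      case (elim n)
      then have "norm x < real n"
        using N by linarith
      then show ?case
        by (simp add: indicator_def)
    qed
  qed
  show "(\<lambda>x. indicator (ball 0 (real n)) x *\<^sub>R w x) \<in> borel_measurable lebesgue" for n
    using assms unfolding weight_def set_integrable_def by (blast intro: borel_measurable_integrable)
qed

text \<open>Identifies \<open>wmeas w\<close> with a measure, which makes additivity over disjoint
  sets available.\<close>

lemma wmeas_eq_density:
  assumes "weight w" "E \<in> sets lebesgue"
  shows "wmeas w E = emeasure (density lebesgue (\<lambda>x. ennreal (w x))) E"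
  unfolding wmeas_def using assms weight_measurable[of w] by (subst emeasure_density) auto

lemma wmeas_mono: "A \<subseteq> B \<Longrightarrow> wmeas w A \<le> wmeas w B"
  unfolding wmeas_def by (intro nn_integral_mono) (auto simp: indicator_def)

lemma wmeas_ball_finite:
  assumes "weight w"
  shows "wmeas w (ball a r) < \<infinity>"
proof -
  have "integrable lebesgue (\<lambda>x. indicator (ball a r) x *\<^sub>R w x)" "\<And>x. 0 \<le> w x"
    using assms by (auto simp: weight_def set_integrable_def)
  then have "(\<integral>\<^sup>+x. ennreal (norm (indicator (ball a r) x *\<^sub>R w x)) \<partial>lebesgue) < \<infinity>"
    by (simp add: integrable_iff_bounded)
  also have "(\<integral>\<^sup>+x. ennreal (norm (indicator (ball a r) x *\<^sub>R w x)) \<partial>lebesgue) = wmeas w (ball a r)"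
    unfolding wmeas_def using \<open>\<And>x. 0 \<le> w x\<close>
    by (intro nn_integral_cong) (auto simp: indicator_def)
  finally show ?thesis .
qed

text \<open>Integrating the \<open>A_one\<close> inequality over \<open>E\<close> bounds the average
  of \<open>w\<close> on the ball times the measure of \<open>E\<close> by \<open>C\<close> times
  the weight of \<open>E\<close>; the measure of \<open>E\<close> is at least
  \<open>\<kappa>\<close> times that of the ball.\<close>

lemma A_one_lower_bound:
  fixes w :: "real^'n \<Rightarrow> real"
  assumes w: "w \<in> A_one" and "0 < \<kappa>"
  shows "\<exists>c>0. \<forall>b R E. 0 < R \<longrightarrow> E \<in> sets lebesgue \<longrightarrow> E \<subseteq> ball b R \<longrightarrow>
    ennreal \<kappa> * emeasure lebesgue (ball b R) \<le> emeasure lebesgue E \<longrightarrow>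
    ennreal c * wmeas w (ball b R) \<le> wmeas w E"
proof -
  obtain C where C: "C > 0" "\<And>a r. 0 < r \<Longrightarrow> AE x in lebesgue. x \<in> ball a r \<longrightarrow>
        average (ball a r) (\<lambda>y. ennreal (w y)) \<le> ennreal (C * w x)" and weight: "weight w"
    using w by (auto simp: A_one_def)
  have "ennreal (\<kappa> / C) * wmeas w (ball b R) \<le> wmeas w E"
    if R: "0 < R" and E: "E \<in> sets lebesgue" "E \<subseteq> ball b R"
      and big: "ennreal \<kappa> * emeasure lebesgue (ball b R) \<le> emeasure lebesgue E" for b R E
  proof -
    define \<beta> where "\<beta> = unit_ball_vol (real CARD('n)) * R ^ CARD('n)"
    have \<beta>: "\<beta> > 0" "emeasure lebesgue (ball b R) = ennreal \<beta>"
      using R by (simp_all add: \<beta>_def emeasure_ball)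
    have "ennreal \<kappa> * wmeas w (ball b R) = wmeas w (ball b R) / ennreal \<beta> * (ennreal \<kappa> * ennreal \<beta>)"
      using \<beta> by (simp add: ennreal_divide_times[symmetric] mult.assoc mult.left_commute)
        (metis (no_types, lifting) ennreal_less_zero_iff ennreal_mult_divide_eq ennreal_neq_top
          ennreal_times_divide mult.commute not_gr_zero)
    also have "\<dots> \<le> wmeas w (ball b R) / ennreal \<beta> * emeasure lebesgue E"
      using big \<beta> by (intro mult_left_mono) auto
    also have "\<dots> = (\<integral>\<^sup>+x. average (ball b R) (\<lambda>y. ennreal (w y)) * indicator E x \<partial>lebesgue)"
      using E \<beta> by (simp add: nn_integral_cmult_indicator average_def wmeas_def)
    also have "\<dots> \<le> (\<integral>\<^sup>+x. ennreal C * (ennreal (w x) * indicator E x) \<partial>lebesgue)"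
      using C(2)[OF R, of b]
    proof (intro nn_integral_mono_AE, eventually_elim)
      case (elim x)
      then show ?case
        using E(2) C(1) by (auto simp: indicator_def ennreal_mult')
    qed
    also have "\<dots> = ennreal C * wmeas w E"
      unfolding wmeas_def using E weight_measurable[OF weight]
      by (intro nn_integral_cmult) auto
    finally have "ennreal (1 / C) * (ennreal \<kappa> * wmeas w (ball b R)) \<le> ennreal (1 / C) * (ennreal C * wmeas w E)"
      by (intro mult_left_mono) auto
    then show ?thesis
      using C(1) \<open>0 < \<kappa>\<close> by (simp add: mult.assoc[symmetric] ennreal_mult'[symmetric])
  qed
  then show ?thesis
    using C(1) \<open>0 < \<kappa>\<close> by (intro exI[of _ "\<kappa> / C"]) auto
qed

text \<open>A Chebyshev argument with a threshold \<open>1 / \<mu>\<close>. The part of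
  \<open>E\<close> where \<open>w\<close> reaches it has measure at most \<open>\<mu>\<close> times
  the weight of \<open>E\<close>. On the rest \<open>(\<mu> * w x) powr (- s)\<close> is at least 1,
  so its measure is controlled by the average of \<open>w powr (- s)\<close>, hence by the
  \<open>A_gt_one\<close> constant.\<close>

lemma A_gt_one_lower_bound:
  fixes w :: "real^'n \<Rightarrow> real"
  assumes w: "w \<in> A_gt_one q" and q: "1 < q" and "0 < \<kappa>"
  shows "\<exists>c>0. \<forall>b R E. 0 < R \<longrightarrow> E \<in> sets lebesgue \<longrightarrow> E \<subseteq> ball b R \<longrightarrow>
    ennreal \<kappa> * emeasure lebesgue (ball b R) \<le> emeasure lebesgue E \<longrightarrow>
    ennreal c * wmeas w (ball b R) \<le> wmeas w E"
proof -
  \<comment> \<open>For the exponent \<open>q\<close>, this \<open>s\<close> is the quotient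
    \<open>p' / p\<close> of the definition, and \<open>q - 1\<close> is
    \<open>p / p'\<close>.\<close>
  define s where "s = 1 / (q - 1)"
  have s: "s > 0" "s * (q - 1) = 1"
    using q by (simp_all add: s_def)
  have weight: "weight w" and w0: "\<And>x. 0 \<le> w x"
    using w by (auto simp: A_gt_one_def weight_def)
  have exponents: "q / (q - 1) / q = s" "q / (q / (q - 1)) = q - 1"
    using q by (simp_all add: s_def)
  define X where "X = (SUP (a, r)\<in>UNIV \<times> {0<..}.
         average (ball a r) (\<lambda>x. ennreal (w x)) *
         ennreal_powr (average (ball a r) (\<lambda>x. ennreal_powr (ennreal (w x)) (- s))) (q - 1))"
  have X: "X < \<infinity>"
    using w unfolding A_gt_one_def Let_def exponents X_def by auto
  \<comment> \<open>Adding 1 makes \<open>A\<close> positive without examining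
    \<open>X\<close>.\<close>
  define A where "A = enn2real X + 1"
  have A: "A > 0" "X \<le> ennreal A"
  proof -
    show "A > 0"
      using enn2real_nonneg[of X] unfolding A_def by linarith
    have "X = ennreal (enn2real X)"
      using X by simp
    also have "\<dots> \<le> ennreal A"
      by (intro ennreal_leI) (simp add: A_def)
    finally show "X \<le> ennreal A" .
  qed
  \<comment> \<open>Since \<open>((2 / \<kappa>) powr (q - 1)) powr (- s) = \<kappa> / 2\<close>,
    taking \<open>\<mu> = \<Lambda> * \<beta> / W\<close> leaves to the part of \<open>E\<close>
    with \<open>\<mu> * w x < 1\<close> at most half of the measure that \<open>E\<close> is assumed
    to have.\<close>
  define \<Lambda> where "\<Lambda> = A * (2 / \<kappa>) powr (q - 1)"
  have \<Lambda>: "\<Lambda> > 0"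
    using A \<open>0 < \<kappa>\<close> by (simp add: \<Lambda>_def)
  have "ennreal (\<kappa> / (2 * \<Lambda>)) * wmeas w (ball b R) \<le> wmeas w E"
    if R: "0 < R" and E: "E \<in> sets lebesgue" "E \<subseteq> ball b R"
      and big: "ennreal \<kappa> * emeasure lebesgue (ball b R) \<le> emeasure lebesgue E" for b R E
  \<comment> \<open>Positivity of the weight on balls is itself deduced from this bound later, so
    the degenerate case has to be treated here.\<close>
  proof (cases "wmeas w (ball b R) = 0")
    case False
    define \<beta> where "\<beta> = unit_ball_vol (real CARD('n)) * R ^ CARD('n)"
    have \<beta>: "\<beta> > 0" "emeasure lebesgue (ball b R) = ennreal \<beta>"
      using R by (simp_all add: \<beta>_def emeasure_ball)
    obtain W where W: "wmeas w (ball b R) = ennreal W" "W > 0"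
      using False wmeas_ball_finite[OF weight, of b R]
      by (metis ennreal_0 ennreal_cases ennreal_less_top infinity_ennreal_def less_irrefl
          order_le_less)
    define \<sigma> where "\<sigma> = (\<integral>\<^sup>+x\<in>ball b R. ennreal_powr (ennreal (w x)) (- s) \<partial>lebesgue)"
    have "average (ball b R) (\<lambda>x. ennreal (w x)) *
         ennreal_powr (average (ball b R) (\<lambda>x. ennreal_powr (ennreal (w x)) (- s))) (q - 1) \<le> X"
      unfolding X_def using R by (intro SUP_upper2[of "(b, R)"]) auto
    then have le: "ennreal (W / \<beta>) * ennreal_powr (\<sigma> / ennreal \<beta>) (q - 1) \<le> ennreal A"
      using A(2) \<beta> W unfolding average_def \<sigma>_def wmeas_def
      by (auto simp: divide_ennreal intro: order.trans)
    \<comment> \<open>As \<open>W > 0\<close>, an infinite integral of \<open>w powr (- s)\<close>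
      would make the \<open>A_gt_one\<close> product infinite.\<close>
    have "\<sigma> < \<infinity>"
    proof (rule ccontr)
      assume "\<not> \<sigma> < \<infinity>"
      then have "ennreal_powr (\<sigma> / ennreal \<beta>) (q - 1) = \<infinity>"
        using q \<beta> by (auto simp: ennreal_powr_def ennreal_top_divide not_less top_unique)
      then show False
        using le W \<beta> by (auto simp: ennreal_mult_top top_unique)
    qed
    then obtain m where m: "m \<ge> 0" "\<sigma> = ennreal (m * \<beta>)"
      using \<beta> by (intro that[of "enn2real \<sigma> / \<beta>"]) auto
    have "\<sigma> / ennreal \<beta> = ennreal m"
      using m \<beta> by (simp add: divide_ennreal)
    then have "ennreal (W / \<beta>) * ennreal (m powr (q - 1)) \<le> ennreal A"
      using le q m(1) by (simp add: ennreal_powr_def)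
    then have "W / \<beta> * m powr (q - 1) \<le> A"
      using A W \<beta> by (simp add: ennreal_mult'[symmetric])
    then have "m powr (q - 1) \<le> A * \<beta> / W"
      using W \<beta> by (simp add: field_simps)
    then have "(m powr (q - 1)) powr s \<le> (A * \<beta> / W) powr s"
      using s by (intro powr_mono2) auto
    then have m_le: "m \<le> (A * \<beta> / W) powr s"
      using s m by (simp add: powr_powr mult.commute)
    define \<mu> where "\<mu> = \<Lambda> * \<beta> / W"
    have \<mu>: "\<mu> > 0"
      using \<Lambda> \<beta> W by (simp add: \<mu>_def)
    have "\<mu> powr (- s) * m \<le> \<mu> powr (- s) * (A * \<beta> / W) powr s"
      using m_le by (intro mult_left_mono) auto
    also have "\<mu> powr (- s) * (A * \<beta> / W) powr s = ((2 / \<kappa>) powr (q - 1)) powr (- s)"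
    proof -
      have "\<mu> = (A * \<beta> / W) * (2 / \<kappa>) powr (q - 1)"
        by (simp add: \<mu>_def \<Lambda>_def)
      then show ?thesis
        using A W \<beta> by (simp only: powr_mult) (simp add: powr_minus)
    qed
    also have "\<dots> = \<kappa> / 2"
      using s \<open>0 < \<kappa>\<close> by (simp add: powr_powr powr_minus mult.commute)
    finally have \<mu>m: "\<mu> powr (- s) * m \<le> \<kappa> / 2" .
    define E1 where "E1 = {x \<in> E. 1 \<le> \<mu> * w x}"
    have E1: "E1 \<in> sets lebesgue"
    proof -
      have "{x \<in> space lebesgue. 1 \<le> \<mu> * w x} \<in> sets lebesgue"
        using weight_measurable[OF weight] by measurable
      moreover have "E1 = E \<inter> {x \<in> space lebesgue. 1 \<le> \<mu> * w x}"
        by (auto simp: E1_def)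
      ultimately show ?thesis
        using E by auto
    qed
    have "emeasure lebesgue E1 = (\<integral>\<^sup>+x. indicator E1 x \<partial>lebesgue)"
      using E1 by simp
    also have "\<dots> \<le> (\<integral>\<^sup>+x. ennreal \<mu> * (ennreal (w x) * indicator E x) \<partial>lebesgue)"
      using w0 \<mu> by (intro nn_integral_mono) (auto simp: E1_def indicator_def ennreal_mult'[symmetric])
    also have "\<dots> = ennreal \<mu> * wmeas w E"
      unfolding wmeas_def using E weight_measurable[OF weight]
      by (intro nn_integral_cmult) auto
    finally have part1: "emeasure lebesgue E1 \<le> ennreal \<mu> * wmeas w E" .
    \<comment> \<open>Zeros of \<open>w\<close> are covered: there \<open>ennreal_powr\<close> with
      a negative exponent is infinite.\<close>
    have small: "1 \<le> ennreal (\<mu> powr (- s)) * ennreal_powr (ennreal (w x)) (- s)"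
      if "\<not> 1 \<le> \<mu> * w x" for x
    proof (cases "w x = 0")
      case True
      then show ?thesis
        using s \<mu> by (simp add: ennreal_powr_def ennreal_mult_top)
    next
      case False
      then have "w x > 0" using w0[of x] by linarith
      have "1 \<le> (\<mu> * w x) powr (- s)"
        using that s \<mu> \<open>w x > 0\<close>
        by (metis ge_one_powr_ge_zero less_eq_real_def mult_pos_pos not_le one_le_inverse_iff
            powr_ge_zero powr_minus powr_mono2 powr_one_eq_one powr_gt_zero)
      also have "\<dots> = \<mu> powr (- s) * w x powr (- s)"
        using \<mu> \<open>w x > 0\<close> by (simp add: powr_mult)
      finally show ?thesis
        using \<open>w x > 0\<close> by (simp add: ennreal_powr_def ennreal_mult'[symmetric])
    qed
    have "emeasure lebesgue (E - E1) = (\<integral>\<^sup>+x. indicator (E - E1) x \<partial>lebesgue)"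
      using E E1 by simp
    also have "\<dots> \<le> (\<integral>\<^sup>+x. ennreal (\<mu> powr (- s)) *
        (ennreal_powr (ennreal (w x)) (- s) * indicator (ball b R) x) \<partial>lebesgue)"
      using small E(2) by (intro nn_integral_mono) (auto simp: E1_def indicator_def)
    also have "\<dots> = ennreal (\<mu> powr (- s)) * \<sigma>"
      unfolding \<sigma>_def
    proof (intro nn_integral_cmult)
      note weight_measurable[OF weight, measurable]
      have [measurable]: "ball b R \<in> sets lebesgue"
        by simp
      have "(\<lambda>x. (if w x = 0 then \<infinity> else ennreal (w x powr (- s))) * indicator (ball b R) x)
        \<in> borel_measurable lebesgue"
        by measurable
      also have "(\<lambda>x. (if w x = 0 then \<infinity> else ennreal (w x powr (- s))) * indicator (ball b R) x) =
        (\<lambda>x. ennreal_powr (ennreal (w x)) (- s) * indicator (ball b R) x)"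
        using s w0 by (auto simp: ennreal_powr_def fun_eq_iff)
      finally show "(\<lambda>x. ennreal_powr (ennreal (w x)) (- s) * indicator (ball b R) x)
        \<in> borel_measurable lebesgue" .
    qed
    also have "\<dots> = ennreal (\<mu> powr (- s) * m * \<beta>)"
      using m \<beta> by (simp add: ennreal_mult'[symmetric] mult.assoc)
    also have "\<dots> \<le> ennreal (\<kappa> / 2 * \<beta>)"
      using \<mu>m \<beta> by (intro ennreal_leI mult_right_mono) auto
    finally have part2: "emeasure lebesgue (E - E1) \<le> ennreal (\<kappa> / 2 * \<beta>)" .
    have "ennreal (\<kappa> * \<beta>) \<le> emeasure lebesgue E"
      using big \<beta> \<open>0 < \<kappa>\<close> by (simp add: ennreal_mult'[symmetric])
    also have "\<dots> = emeasure lebesgue E1 + emeasure lebesgue (E - E1)"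
    proof -
      have "E1 \<union> (E - E1) = E"
        by (auto simp: E1_def)
      then show ?thesis
        using plus_emeasure[OF E1 sets.Diff[OF E(1) E1]] by (metis Diff_disjoint)
    qed
    also have "\<dots> \<le> ennreal \<mu> * wmeas w E + ennreal (\<kappa> / 2 * \<beta>)"
      by (intro add_mono part1 part2)
    finally have sum: "ennreal (\<kappa> * \<beta>) \<le> ennreal \<mu> * wmeas w E + ennreal (\<kappa> / 2 * \<beta>)" .
    obtain v where v: "wmeas w E = ennreal v" "v \<ge> 0"
      using wmeas_mono[OF E(2), of w] W(1) by (metis ennreal_cases neq_top_trans ennreal_neq_top)
    have "\<kappa> * \<beta> \<le> \<mu> * v + \<kappa> / 2 * \<beta>"
      using sum v \<mu> \<beta> \<open>0 < \<kappa>\<close> by (simp add: ennreal_mult'[symmetric] ennreal_plus[symmetric] del: ennreal_plus)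
    then have "\<kappa> / 2 * \<beta> \<le> \<mu> * v"
      by linarith
    then have "\<kappa> / 2 * \<beta> \<le> \<Lambda> * \<beta> / W * v"
      by (simp add: \<mu>_def)
    then have "\<kappa> / (2 * \<Lambda>) * W \<le> v"
      using \<beta> W \<Lambda> by (simp add: field_simps)
    then show ?thesis
      using W v \<Lambda> \<open>0 < \<kappa>\<close> by (simp add: ennreal_mult'[symmetric])
  qed simp
  then show ?thesis
    using \<Lambda> \<open>0 < \<kappa>\<close> by (intro exI[of _ "\<kappa> / (2 * \<Lambda>)"]) auto
qed

lemma A_real_lower_bound:
  fixes w :: "real^'n \<Rightarrow> real"
  assumes w: "w \<in> A_real q" and q: "1 \<le> q" and "0 < \<kappa>"
  obtains c where "0 < c" "\<And>b R E. 0 < R \<Longrightarrow> E \<in> sets lebesgue \<Longrightarrow> E \<subseteq> ball b R \<Longrightarrow>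
    ennreal \<kappa> * emeasure lebesgue (ball b R) \<le> emeasure lebesgue E \<Longrightarrow>
    ennreal c * wmeas w (ball b R) \<le> wmeas w E"
proof (cases "q = 1")
  case True
  then show ?thesis
    using w A_one_lower_bound[of w \<kappa>] \<open>0 < \<kappa>\<close> that by (auto simp: A_real_def)
next
  case False
  then show ?thesis
    using w q A_gt_one_lower_bound[of w q \<kappa>] \<open>0 < \<kappa>\<close> that by (auto simp: A_real_def)
qed

lemma A_real_weight: "w \<in> A_real q \<Longrightarrow> weight w"
  by (auto simp: A_real_def A_one_def A_gt_one_def split: if_splits)

text \<open>A ball occupies a positive proportion of each larger concentric ball. Weight zero on it
  would therefore spread to balls of arbitrarily large radius, and \<open>w\<close> would vanish
  almost everywhere.\<close>

lemma A_real_wmeas_ball_pos: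
  fixes w :: "real^'n \<Rightarrow> real"
  assumes w: "w \<in> A_real q" and q: "1 \<le> q" and "0 < r"
  shows "0 < wmeas w (ball a r)"
proof (rule ccontr)
  assume "\<not> 0 < wmeas w (ball a r)"
  then have zero: "wmeas w (ball a r) = 0"
    by simp
  note weight = A_real_weight[OF w]
  then have w0: "0 \<le> w x" for x
    by (simp add: weight_def)
  have "AE x in lebesgue. x \<in> ball a (r + real n) \<longrightarrow> w x = 0" for n
  proof -
    define \<kappa> where "\<kappa> = (r / (r + real n)) ^ CARD('n)"
    have "\<kappa> > 0"
      using \<open>0 < r\<close> by (simp add: \<kappa>_def)
    then obtain c where c: "0 < c" "\<And>b R E. 0 < R \<Longrightarrow> E \<in> sets lebesgue \<Longrightarrow> E \<subseteq> ball b R \<Longrightarrow>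
      ennreal \<kappa> * emeasure lebesgue (ball b R) \<le> emeasure lebesgue E \<Longrightarrow>
      ennreal c * wmeas w (ball b R) \<le> wmeas w E"
      using A_real_lower_bound[OF w q] by blast
    have "\<kappa> * (unit_ball_vol (real CARD('n)) * (r + real n) ^ CARD('n)) =
      unit_ball_vol (real CARD('n)) * r ^ CARD('n)"
      using \<open>0 < r\<close> by (simp add: \<kappa>_def power_divide)
    then have "ennreal \<kappa> * emeasure lebesgue (ball a (r + real n)) = emeasure lebesgue (ball a r)"
      using \<open>0 < r\<close> \<open>\<kappa> > 0\<close> by (simp add: emeasure_ball ennreal_mult'[symmetric])
    moreover have "ball a r \<subseteq> ball a (r + real n)"
      by (intro subset_ball) simp
    ultimately have "ennreal c * wmeas w (ball a (r + real n)) \<le> 0"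
      using c(2)[of "r + real n" "ball a r" a] \<open>0 < r\<close> zero by auto
    then have "wmeas w (ball a (r + real n)) = 0"
      using c(1) by auto
    then have "AE x in lebesgue. ennreal (w x) * indicator (ball a (r + real n)) x = 0"
      unfolding wmeas_def using weight_measurable[OF weight] fmeasurableD[OF lmeasurable_ball[of a "r + real n"]]
      by (subst (asm) nn_integral_0_iff_AE) (auto intro!: borel_measurable_times_ennreal borel_measurable_indicator)
    then show ?thesis
    proof eventually_elim
      case (elim x)
      then show ?case
        using w0[of x] by (auto simp: ennreal_eq_0_iff indicator_def split: if_splits)
    qed
  qed
  then have "AE x in lebesgue. \<forall>n. x \<in> ball a (r + real n) \<longrightarrow> w x = 0"
    unfolding AE_all_countable by blast
  then have "AE x in lebesgue. w x = 0"
  proof eventually_elim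
    case (elim x)
    obtain n :: nat where "dist a x < real n"
      using reals_Archimedean2 by blast
    then have "x \<in> ball a (r + real n)"
      using \<open>0 < r\<close> by auto
    then show ?case
      using elim by blast
  qed
  then show False
    using weight by (simp add: weight_def)
qed

text \<open>The shell between the two balls contains a ball of radius \<open>r / 2\<close>, which
  has \<open>(1/4) ^ CARD('n)\<close> of the volume of the doubled ball and hence a fixed proportion
  of its weight. The inner ball gets at most the remainder.\<close>

lemma A_real_reverse_doubling:
  fixes w :: "real^'n \<Rightarrow> real"
  assumes w: "w \<in> A_real q" and q: "1 \<le> q"
  obtains \<sigma> where "0 < \<sigma>" "\<sigma> < 1"
    "\<And>a r. 0 < r \<Longrightarrow> wmeas w (ball a r) \<le> ennreal \<sigma> * wmeas w (ball a (2 * r))"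
proof -
  note weight = A_real_weight[OF w]
  obtain c where c: "0 < c" "\<And>b R E. 0 < R \<Longrightarrow> E \<in> sets lebesgue \<Longrightarrow> E \<subseteq> ball b R \<Longrightarrow>
      ennreal ((1/4) ^ CARD('n)) * emeasure lebesgue (ball b R) \<le> emeasure lebesgue E \<Longrightarrow>
      ennreal c * wmeas w (ball b R) \<le> wmeas w E"
    using A_real_lower_bound[OF w q, of "(1/4) ^ CARD('n)"] by auto
  \<comment> \<open>The minimum places \<open>1 - c'\<close> strictly between 0 and 1.\<close>
  define c' where "c' = min c (1/2)"
  have c': "0 < c'" "c' < 1" "c' \<le> c"
    using c by (auto simp: c'_def)
  have "wmeas w (ball a r) \<le> ennreal (1 - c') * wmeas w (ball a (2 * r))" if r: "0 < r" for a r
  proof -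
    \<comment> \<open>Any unit vector serves; \<open>undefined\<close> picks some coordinate of the
      index type.\<close>
    define e :: "real^'n" where "e = axis undefined 1"
    have e: "norm e = 1"
      by (simp add: e_def)
    define E where "E = ball (a + (3/2 * r) *\<^sub>R e) (r / 2)"
    have dist_centre: "dist a (a + (3/2 * r) *\<^sub>R e) = 3/2 * r"
      using r e by (simp add: dist_norm)
    have sub: "E \<subseteq> ball a (2 * r)"
    proof
      fix x assume "x \<in> E"
      then show "x \<in> ball a (2 * r)"
        using dist_triangle[of a x "a + (3/2 * r) *\<^sub>R e"] dist_centre by (simp add: E_def)
    qed
    have disj: "ball a r \<inter> E = {}"
    proof -
      have False if "x \<in> ball a r" "x \<in> E" for x
        using that dist_triangle[of a "a + (3/2 * r) *\<^sub>R e" x] dist_centre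
        by (simp add: E_def dist_commute)
      then show ?thesis by blast
    qed
    have "ennreal ((1/4) ^ CARD('n)) * emeasure lebesgue (ball a (2 * r)) = emeasure lebesgue E"
    proof -
      have "(1/4) ^ CARD('n) * (2 * r) ^ CARD('n) = (1/4 * (2 * r)) ^ CARD('n)"
        by (rule power_mult_distrib[symmetric])
      then have "(1/4) ^ CARD('n) * (unit_ball_vol (real CARD('n)) * (2 * r) ^ CARD('n)) =
        unit_ball_vol (real CARD('n)) * (r / 2) ^ CARD('n)"
        by (simp only: mult.left_commute[of "(1/4) ^ CARD('n)"]) simp
      then have "ennreal ((1/4) ^ CARD('n)) *
          ennreal (unit_ball_vol (real CARD('n)) * (2 * r) ^ CARD('n)) =
        ennreal (unit_ball_vol (real CARD('n)) * (r / 2) ^ CARD('n))"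
        by (subst ennreal_mult'[symmetric]) (auto simp only: zero_le_power zero_le_divide_1_iff zero_le_numeral)
      then show ?thesis
        using r emeasure_ball[of "2 * r" a] emeasure_ball[of "r / 2" "a + (3/2 * r) *\<^sub>R e"]
        by (simp add: E_def)
    qed
    then have "ennreal c * wmeas w (ball a (2 * r)) \<le> wmeas w E"
      using c(2)[of "2 * r" E a] r sub by (simp add: E_def)
    moreover have "ennreal c' * wmeas w (ball a (2 * r)) \<le> ennreal c * wmeas w (ball a (2 * r))"
      using c' by (intro mult_right_mono ennreal_leI) auto
    ultimately have E_ge: "ennreal c' * wmeas w (ball a (2 * r)) \<le> wmeas w E"
      by simp
    have "wmeas w (ball a r) + wmeas w E = wmeas w (ball a r \<union> E)"
      using disj by (simp add: wmeas_eq_density weight E_def plus_emeasure)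
    also have "\<dots> \<le> wmeas w (ball a (2 * r))"
      using sub r by (intro wmeas_mono) auto
    finally have sum: "wmeas w (ball a r) + wmeas w E \<le> wmeas w (ball a (2 * r))" .
    obtain W where W: "wmeas w (ball a (2 * r)) = ennreal W" "W \<ge> 0"
      using wmeas_ball_finite[OF weight, of a "2 * r"] by (cases "wmeas w (ball a (2 * r))") auto
    obtain V where V: "wmeas w (ball a r) = ennreal V" "V \<ge> 0"
      using wmeas_ball_finite[OF weight, of a r] by (cases "wmeas w (ball a r)") auto
    have "ennreal V + ennreal c' * ennreal W \<le> ennreal W"
      using sum E_ge W V by (metis add_left_mono order.trans)
    then have "V + c' * W \<le> W"
      using V W c' by (simp add: ennreal_mult'[symmetric] ennreal_plus[symmetric] del: ennreal_plus)
    then show ?thesis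
      using V W c' by (simp add: ennreal_mult'[symmetric] algebra_simps)
  qed
  then show ?thesis
    using c' by (intro that[of "1 - c'"]) auto
qed

lemma Muckenhoupt_A_imp_A_real:
  assumes "w \<in> Muckenhoupt_A p"
  obtains q where "1 \<le> q" "w \<in> A_real q"
proof (cases "p = \<infinity>")
  case False
  with assms have "1 \<le> p" "w \<in> A_real (real_of_ereal p)"
    by (auto simp: Muckenhoupt_A_def split: if_splits)
  with False show ?thesis
    by (intro that[of "real_of_ereal p"]) (cases p; auto)+
qed (use assms that in \<open>auto simp: Muckenhoupt_A_def\<close>)

subsection \<open>Orlicz norms of layered functions\<close>

text \<open>At each point at most one term of \<open>f\<close> is nonzero, so \<open>\<Phi>\<close>
  may be applied term by term; \<open>\<Phi> 0 = 0\<close> disposes of the points outside all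
  layers.\<close>

lemma nn_integral_modular_simple:
  fixes f :: "real^'n \<Rightarrow> 'a::{real_normed_field,euclidean_space}"
  assumes \<Phi>: "young_function \<Phi>" and weight: "weight w" and B: "B \<in> sets lebesgue"
    and J: "finite J" and E: "\<And>k. k \<in> J \<Longrightarrow> E k \<in> sets lebesgue" "disjoint_family_on E J"
    and \<alpha>: "\<And>k. k \<in> J \<Longrightarrow> 0 \<le> \<alpha> k" and f: "\<And>y. f y = of_real (\<Sum>k\<in>J. \<alpha> k * indicator (E k) y)"
  shows "(\<integral>\<^sup>+y. \<Phi> (norm (restr B f y) / l) * ennreal (w y) \<partial>lebesgue) =
    (\<Sum>k\<in>J. \<Phi> (\<alpha> k / l) * wmeas w (E k \<inter> B))"
proof -
  have "\<Phi> (norm (restr B f y) / l) * ennreal (w y) =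
    (\<Sum>k\<in>J. \<Phi> (\<alpha> k / l) * (ennreal (w y) * indicator (E k \<inter> B) y))" for y
  proof (cases "y \<in> B \<and> (\<exists>k\<in>J. y \<in> E k)")
    case True
    then obtain k where k: "k \<in> J" "y \<in> E k" "y \<in> B" by blast
    have other: "y \<notin> E j" if "j \<in> J - {k}" for j
      using E(2) k that by (auto simp: disjoint_family_on_def)
    have "f y = of_real (\<alpha> k)"
      using k other J by (simp add: f sum.remove[OF J k(1)] sum.neutral)
    then show ?thesis
      using k other J \<alpha>[OF k(1)] by (simp add: restr_def sum.remove[OF J k(1)] sum.neutral)
  next
    case False
    then have "restr B f y = 0"
      by (auto simp: restr_def f indicator_def)
    moreover have "\<Phi> 0 = 0"
      using \<Phi> by (simp add: young_function_def)
    ultimately show ?thesis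
      using False by (auto simp: indicator_def intro!: sum.neutral[symmetric])
  qed
  then have "(\<integral>\<^sup>+y. \<Phi> (norm (restr B f y) / l) * ennreal (w y) \<partial>lebesgue) =
    (\<integral>\<^sup>+y. (\<Sum>k\<in>J. \<Phi> (\<alpha> k / l) * (ennreal (w y) * indicator (E k \<inter> B) y)) \<partial>lebesgue)"
    by simp
  also have "\<dots> = (\<Sum>k\<in>J. \<integral>\<^sup>+y. \<Phi> (\<alpha> k / l) * (ennreal (w y) * indicator (E k \<inter> B) y) \<partial>lebesgue)"
    using weight_measurable[OF weight] E(1) B by (intro nn_integral_sum) auto
  also have "\<dots> = (\<Sum>k\<in>J. \<Phi> (\<alpha> k / l) * wmeas w (E k \<inter> B))"
    unfolding wmeas_def using weight_measurable[OF weight] E(1) B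
    by (intro sum.cong nn_integral_cmult) auto
  finally show ?thesis .
qed

text \<open>Grouping by the value of \<open>e\<close> leaves the series of
  \<open>(d + 1) * \<sigma> ^ d\<close>, the derivative of the geometric series.\<close>

lemma sum_power_le_of_card_fibres:
  fixes \<sigma> :: real
  assumes J: "finite J" and card: "\<And>d. card {k \<in> J. e k = d} \<le> Suc d" and \<sigma>: "0 \<le> \<sigma>" "\<sigma> < 1"
  shows "(\<Sum>k\<in>J. \<sigma> ^ e k) \<le> 1 / (1 - \<sigma>)\<^sup>2"
proof -
  have sums: "(\<lambda>d. real (Suc d) * \<sigma> ^ d) sums (1 / (1 - \<sigma>)\<^sup>2)"
    using geometric_deriv_sums[of \<sigma>] \<sigma> by simp
  have "(\<Sum>k\<in>J. \<sigma> ^ e k) = (\<Sum>d\<in>e ` J. \<Sum>k\<in>{k \<in> J. e k = d}. \<sigma> ^ e k)"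
    using J by (intro sum.group[symmetric]) auto
  also have "\<dots> = (\<Sum>d\<in>e ` J. real (card {k \<in> J. e k = d}) * \<sigma> ^ d)"
    by (intro sum.cong) auto
  also have "\<dots> \<le> (\<Sum>d\<in>e ` J. real (Suc d) * \<sigma> ^ d)"
    using card \<sigma> by (intro sum_mono mult_right_mono of_nat_mono) auto
  also have "\<dots> \<le> 1 / (1 - \<sigma>)\<^sup>2"
    unfolding sums_unique[OF sums] using J \<sigma> sums
    by (intro sum_le_suminf) (auto intro: sums_summable)
  finally show ?thesis .
qed

lemma sum_power_diff_le:
  fixes \<sigma> :: real
  assumes "0 \<le> \<sigma>" "\<sigma> < 1" "J \<subseteq> {..m}"
  shows "(\<Sum>k\<in>J. \<sigma> ^ (m - k)) \<le> 1 / (1 - \<sigma>)"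
proof -
  have "(\<Sum>k\<in>J. \<sigma> ^ (m - k)) \<le> (\<Sum>k\<le>m. \<sigma> ^ (m - k))"
    using assms by (intro sum_mono2) auto
  also have "\<dots> = (\<Sum>k\<le>m. \<sigma> ^ k)"
    by (rule sum.nat_diff_reindex[of "\<lambda>k. \<sigma> ^ k" "Suc m", unfolded lessThan_Suc_atMost diff_Suc_Suc])
  also have "\<dots> \<le> (\<Sum>k. \<sigma> ^ k)"
    using assms by (intro sum_le_suminf) (auto intro: summable_geometric)
  also have "\<dots> = 1 / (1 - \<sigma>)"
    using assms by (intro suminf_geometric) auto
  finally show ?thesis .
qed

section \<open>Strong and weak Orlicz norms on balls\<close>

locale orlicz_weight =
  fixes \<Phi> :: "real \<Rightarrow> ennreal" and w :: "real^'n \<Rightarrow> real"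
  assumes young: "young_function \<Phi>"
    and weight: "weight w"
    and wmeas_ball_pos: "0 < r \<Longrightarrow> 0 < wmeas w (ball a r)"
begin

text \<open>\<open>1 / U a r\<close> is the Orlicz norm of the indicator function of \<open>ball a r\<close>.\<close>

definition U :: "real^'n \<Rightarrow> real \<Rightarrow> real" where
  "U a r = enn2real (young_inv \<Phi> (inverse (wmeas w (ball a r))))"

lemma inverse_wmeas_ball:
  assumes "0 < r"
  shows "0 < inverse (wmeas w (ball a r))" "inverse (wmeas w (ball a r)) < \<infinity>"
    "inverse (wmeas w (ball a r)) * wmeas w (ball a r) = 1"
proof -
  obtain W where W: "wmeas w (ball a r) = ennreal W" "W > 0"
    using wmeas_ball_pos[OF assms, of a] wmeas_ball_finite[OF weight, of a r]
    by (cases "wmeas w (ball a r)") auto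
  then show "0 < inverse (wmeas w (ball a r))" "inverse (wmeas w (ball a r)) < \<infinity>"
    "inverse (wmeas w (ball a r)) * wmeas w (ball a r) = 1"
    by (auto simp: inverse_ennreal ennreal_mult'[symmetric])
qed

lemma ennreal_U:
  assumes "0 < r"
  shows "ennreal (U a r) = young_inv \<Phi> (inverse (wmeas w (ball a r)))"
  using young_inv_finite[OF young inverse_wmeas_ball(2)[OF assms]] by (simp add: U_def)

lemma U_pos:
  assumes "0 < r"
  shows "0 < U a r"
  using young_inv_pos[OF young inverse_wmeas_ball(1)[OF assms]] ennreal_U[OF assms]
  by (metis ennreal_less_zero_iff)

text \<open>For \<open>\<theta> = 1\<close> this is \<open>young_at_inv_le\<close>. Convexity moves
  a factor \<open>\<theta>\<close> out of \<open>\<Phi>\<close>, and this is what makes room for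
  adding up many layers.\<close>

lemma modular_U_le:
  assumes r: "0 < r" and \<theta>: "0 \<le> \<theta>" "\<theta> \<le> 1"
  shows "\<Phi> (\<theta> * U a r) * wmeas w (ball a r) \<le> ennreal \<theta>"
proof -
  have "\<Phi> (\<theta> * U a r) * wmeas w (ball a r) \<le>
      ennreal \<theta> * inverse (wmeas w (ball a r)) * wmeas w (ball a r)"
  proof (intro mult_right_mono)
    have "\<Phi> (\<theta> * U a r) \<le> ennreal \<theta> * \<Phi> (U a r)"
      using \<theta> U_pos[OF r, of a] by (intro young_scale[OF young]) auto
    also have "\<Phi> (U a r) \<le> inverse (wmeas w (ball a r))"
      unfolding U_def using inverse_wmeas_ball[OF r] by (intro young_at_inv_le[OF young])
    finally show "\<Phi> (\<theta> * U a r) \<le> ennreal \<theta> * inverse (wmeas w (ball a r))"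
      by (simp add: mult_left_mono)
  qed auto
  also have "\<dots> = ennreal \<theta>"
    using inverse_wmeas_ball(3)[OF r, of a] by (simp add: mult.assoc)
  finally show ?thesis .
qed

lemma modular_gt_one:
  assumes r: "0 < r" and "U a r < t"
  shows "1 < \<Phi> t * wmeas w (ball a r)"
proof -
  have "inverse (wmeas w (ball a r)) < \<Phi> t"
    using assms ennreal_U[OF r, of a] U_pos[OF r, of a]
    by (intro young_gt_of_inv_less[OF young]) (metis ennreal_lessI less_trans)
  then have "inverse (wmeas w (ball a r)) * wmeas w (ball a r) < \<Phi> t * wmeas w (ball a r)"
    using wmeas_ball_pos[OF r, of a] wmeas_ball_finite[OF weight, of a r]
    by (intro ennreal_mult_strict_right_mono) auto
  then show ?thesis
    using inverse_wmeas_ball(3)[OF r, of a] by simp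
qed

text \<open>If an admissible \<open>l\<close> were below \<open>S / U a r\<close>, some level
  \<open>t\<close> would lie strictly between \<open>U a r\<close> and \<open>S / l\<close>. Almost
  all of the ball lies in its level set, so \<open>modular_gt_one\<close> contradicts
  admissibility.\<close>

lemma weak_orlicz_norm_ge:
  fixes g :: "real^'n \<Rightarrow> 'a::{real_normed_field,euclidean_space}"
  assumes r: "0 < r" and S: "AE x in lebesgue. x \<in> ball a r \<longrightarrow> S \<le> norm (g x)"
  shows "ennreal (S / U a r) \<le> weak_orlicz_norm \<Phi> w (restr (ball a r) g)"
  unfolding weak_orlicz_norm_def
proof (rule INF_greatest)
  fix l
  assume "l \<in> {l. 0 < l \<and> (SUP t\<in>{0<..}. \<Phi> t * wmeas w {x. t < norm (restr (ball a r) g x) / l}) \<le> 1}"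
  then have l: "0 < l" and le: "(SUP t\<in>{0<..}. \<Phi> t * wmeas w {x. t < norm (restr (ball a r) g x) / l}) \<le> 1"
    by auto
  show "ennreal (S / U a r) \<le> ennreal l"
  proof (rule ccontr)
    assume "\<not> ?thesis"
    then have "l < S / U a r"
      by (meson ennreal_leI not_le)
    then have "U a r < S / l"
      using l U_pos[OF r, of a] by (simp add: field_simps)
    then obtain t where t: "U a r < t" "t < S / l"
      using dense by blast
    have "wmeas w (ball a r) \<le> wmeas w {x. t < norm (restr (ball a r) g x) / l}"
      unfolding wmeas_def using S
    proof (intro nn_integral_mono_AE, eventually_elim)
      case (elim x)
      show ?case
      proof (cases "x \<in> ball a r")
        case True
        then have "t < norm (g x) / l"
          using elim t l by (meson divide_right_mono less_imp_le order_less_le_trans)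
        then show ?thesis
          using True by (simp add: restr_def)
      qed simp
    qed
    then have "\<Phi> t * wmeas w (ball a r) \<le> \<Phi> t * wmeas w {x. t < norm (restr (ball a r) g x) / l}"
      by (rule mult_left_mono) simp
    also have "\<dots> \<le> 1"
      using le t U_pos[OF r, of a] by (auto simp: SUP_le_iff)
    finally show False
      using modular_gt_one[OF r t(1)] by simp
  qed
qed

end

text \<open>\<open>\<psi>\<close> stands for the radial version of \<open>\<phi>1\<close>. As
  \<open>\<psi> s / U b s\<close> is the Orlicz norm of \<open>\<psi> s\<close> times the indicator
  of \<open>ball b s\<close>, the growth assumption is the Morrey bound for a single ball; its two
  centres are unrelated because Morrey balls need not be centred where the layers are.\<close>

locale orlicz_ball_growth = orlicz_weight \<Phi> w
  for \<Phi> :: "real \<Rightarrow> ennreal" and w :: "real^'n \<Rightarrow> real" +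
  fixes \<psi> :: "real \<Rightarrow> real" and C \<sigma> :: real
  assumes \<sigma>: "0 \<le> \<sigma>" "\<sigma> < 1"
    and reverse_doubling: "0 < r \<Longrightarrow> wmeas w (ball a r) \<le> ennreal \<sigma> * wmeas w (ball a (2 * r))"
    and C: "0 < C"
    and \<psi>_pos: "0 < r \<Longrightarrow> 0 < \<psi> r"
    and \<psi>_decreasing: "0 < r \<Longrightarrow> r \<le> s \<Longrightarrow> \<psi> s \<le> \<psi> r"
    and \<psi>_growth: "0 < s \<Longrightarrow> s \<le> r \<Longrightarrow> \<psi> s / U b s \<le> C * (\<psi> r / U a r)"
begin

text \<open>This constant will bound the Morrey norm of the test functions. In a ball of radius
  \<open>R\<close> the layers reaching radius \<open>R\<close> contribute \<open>1 / D\<close> to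
  the modular and the smaller ones the two geometric series times \<open>2 * C / D\<close>;
  \<open>D\<close> makes the total at most 1. The 1 inside the parentheses secures
  \<open>2 * C / D \<le> 1\<close>, the range in which \<open>modular_U_le\<close> applies.\<close>

definition D :: real where
  "D = 1 + 2 * C * (1 + 1 / (1 - \<sigma>)\<^sup>2 + 1 / (1 - \<sigma>))"

lemma reverse_doubling_iterate:
  assumes "0 < r"
  shows "wmeas w (ball a r) \<le> ennreal (\<sigma> ^ j) * wmeas w (ball a (2 ^ j * r))"
proof (induction j)
  case (Suc j)
  have "wmeas w (ball a (2 ^ j * r)) \<le> ennreal \<sigma> * wmeas w (ball a (2 ^ Suc j * r))"
    using reverse_doubling[of "2 ^ j * r" a] assms by (simp add: mult.assoc)
  then have "ennreal (\<sigma> ^ j) * wmeas w (ball a (2 ^ j * r)) \<le>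
      ennreal (\<sigma> ^ j) * (ennreal \<sigma> * wmeas w (ball a (2 ^ Suc j * r)))"
    by (rule mult_left_mono) simp
  also have "\<dots> = ennreal (\<sigma> ^ Suc j) * wmeas w (ball a (2 ^ Suc j * r))"
    using \<sigma> by (simp add: ennreal_mult'[symmetric] mult.assoc[symmetric] mult.commute)
  finally show ?case
    using Suc by (rule order.trans[rotated])
qed simp

lemma D_gt: "1 \<le> D" "2 * C \<le> D" "1 / D + 2 * C / D * (1 / (1 - \<sigma>)\<^sup>2 + 1 / (1 - \<sigma>)) \<le> 1"
proof -
  have "0 \<le> 1 / (1 - \<sigma>)\<^sup>2 + 1 / (1 - \<sigma>)"
    using \<sigma> by (intro add_nonneg_nonneg) auto
  then have *: "0 \<le> 2 * C * (1 / (1 - \<sigma>)\<^sup>2 + 1 / (1 - \<sigma>))"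
    using C by (intro mult_nonneg_nonneg) auto
  have D: "D = 1 + 2 * C + 2 * C * (1 / (1 - \<sigma>)\<^sup>2 + 1 / (1 - \<sigma>))"
    by (simp add: D_def algebra_simps)
  show "1 \<le> D" "2 * C \<le> D"
    using * C by (auto simp: D)
  have "1 / D + 2 * C / D * (1 / (1 - \<sigma>)\<^sup>2 + 1 / (1 - \<sigma>)) =
      (1 + 2 * C * (1 / (1 - \<sigma>)\<^sup>2 + 1 / (1 - \<sigma>))) / D"
    by (simp only: add_divide_distrib times_divide_eq_left)
  also have "\<dots> \<le> 1"
    using * C \<open>1 \<le> D\<close> by (subst divide_le_eq_1_pos) (auto simp: D)
  finally show "1 / D + 2 * C / D * (1 / (1 - \<sigma>)\<^sup>2 + 1 / (1 - \<sigma>)) \<le> 1" .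
qed

text \<open>The growth condition at the outer radius of layer \<open>k'\<close> makes the modular of
  that ball at most \<open>2 * C / D\<close>, even at twice the height of layer \<open>k'\<close>.
  Layer \<open>k\<close> is no higher than that, and iterated reverse doubling leaves its ball only
  the fraction \<open>\<sigma> ^ (k' - k)\<close> of the weight.\<close>

lemma modular_layer_le:
  assumes r: "0 < r" "0 < R" and k: "k \<le> k'" "2 ^ Suc k' * r < R"
    and half: "\<psi> (2 ^ Suc k * r) \<le> 2 * \<psi> (2 ^ Suc k' * r)"
  shows "\<Phi> (\<psi> (2 ^ Suc k * r) / (D * \<psi> R / U a R)) * wmeas w (ball x (2 ^ Suc k * r)) \<le>
    ennreal (2 * C / D * \<sigma> ^ (k' - k))"
proof -
  define s where "s = 2 ^ Suc k * r"
  define s' where "s' = 2 ^ Suc k' * r"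
  define l where "l = D * \<psi> R / U a R"
  have s: "s > 0" "s' > 0" "s' = 2 ^ (k' - k) * s"
    using r k by (auto simp: s_def s'_def power_add[symmetric] mult.assoc[symmetric])
  have l: "l > 0"
    using D_gt(1) \<psi>_pos[OF r(2)] U_pos[OF r(2), of a] by (simp add: l_def)
  have "\<psi> s' / U x s' \<le> C * (\<psi> R / U a R)"
    using s k by (intro \<psi>_growth) (auto simp: s'_def)
  then have "\<psi> s' \<le> C / D * l * U x s'"
    using U_pos[OF s(2), of x] D_gt(1) by (simp add: l_def field_simps)
  then have "\<psi> s \<le> 2 * (C / D * l * U x s')"
    using half unfolding s_def[symmetric] s'_def[symmetric] by linarith
  then have "\<psi> s / l \<le> 2 * C / D * U x s'"
    using l by (simp add: pos_divide_le_eq mult_ac)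
  moreover have "0 \<le> \<psi> s / l"
    using \<psi>_pos[OF s(1)] l by simp
  ultimately have "\<Phi> (\<psi> s / l) \<le> \<Phi> (2 * C / D * U x s')"
    by (intro young_mono[OF young])
  then have "\<Phi> (\<psi> s / l) * wmeas w (ball x s) \<le>
      \<Phi> (2 * C / D * U x s') * (ennreal (\<sigma> ^ (k' - k)) * wmeas w (ball x s'))"
    unfolding s(3) by (intro mult_mono reverse_doubling_iterate s) auto
  also have "\<dots> = ennreal (\<sigma> ^ (k' - k)) * (\<Phi> (2 * C / D * U x s') * wmeas w (ball x s'))"
    by (simp add: mult_ac)
  also have "\<dots> \<le> ennreal (\<sigma> ^ (k' - k)) * ennreal (2 * C / D)"
    using D_gt C s by (intro mult_left_mono modular_U_le) auto
  also have "\<dots> = ennreal (2 * C / D * \<sigma> ^ (k' - k))"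
    using \<sigma> by (subst ennreal_mult'[symmetric]) (auto simp: mult.commute)
  finally show ?thesis
    by (simp add: s_def l_def)
qed

text \<open>Layers of radius at least \<open>R\<close> have height at most \<open>\<psi> R\<close>. A smaller layer \<open>k\<close> is compared with the
  layer \<open>min (k + e k) m\<close>, where \<open>m\<close> is the largest layer below \<open>R\<close>: the heights differ by a factor of at
  most two, whereas the weighted measures grow geometrically.\<close>

lemma orlicz_norm_layers_le:
  fixes f :: "real^'n \<Rightarrow> 'a::{real_normed_field,euclidean_space}"
  assumes r: "0 < r" "0 < R" and J: "finite J"
    and E: "\<And>k. k \<in> J \<Longrightarrow> E k \<in> sets lebesgue" "\<And>k. k \<in> J \<Longrightarrow> E k \<subseteq> ball x (2 ^ Suc k * r)"
      "disjoint_family_on E J"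
    and e: "\<And>k l. k \<in> J \<Longrightarrow> k \<le> l \<Longrightarrow> l \<le> k + e k \<Longrightarrow> \<psi> (2 ^ Suc k * r) \<le> 2 * \<psi> (2 ^ Suc l * r)"
    and card: "\<And>d. card {k \<in> J. e k = d} \<le> Suc d"
    and f: "\<And>y. f y = of_real (\<Sum>k\<in>J. \<psi> (2 ^ Suc k * r) * indicator (E k) y)"
  shows "orlicz_norm \<Phi> w (restr (ball a R) f) \<le> ennreal (D * \<psi> R / U a R)"
proof -
  define l where "l = D * \<psi> R / U a R"
  have l: "l > 0"
    using D_gt(1) \<psi>_pos[OF r(2)] U_pos[OF r(2), of a] by (simp add: l_def)
  define mass where "mass k = \<Phi> (\<psi> (2 ^ Suc k * r) / l) * wmeas w (E k \<inter> ball a R)" for k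
  define J1 where "J1 = {k \<in> J. 2 ^ Suc k * r < R}"
  define J2 where "J2 = {k \<in> J. R \<le> 2 ^ Suc k * r}"
  have split: "J = J1 \<union> J2" "J1 \<inter> J2 = {}" and fin: "finite J1" "finite J2"
    using J by (auto simp: J1_def J2_def)
  have small: "(\<Sum>k\<in>J1. mass k) \<le> ennreal (2 * C / D * (1 / (1 - \<sigma>)\<^sup>2 + 1 / (1 - \<sigma>)))"
  proof -
    \<comment> \<open>If \<open>J1\<close> is empty, \<open>m\<close> is unspecified but every sum
      over \<open>J1\<close> vanishes.\<close>
    define m where "m = Max J1"
    have "mass k \<le> ennreal (2 * C / D * (\<sigma> ^ e k + \<sigma> ^ (m - k)))" if k: "k \<in> J1" for k
    proof -
      define k' where "k' = min (k + e k) m"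
      have m: "m \<in> J1" "k \<le> m"
        using k fin by (auto simp: m_def intro: Max_in Max_ge)
      have k': "k \<le> k'" "k' \<le> k + e k" "k' \<le> m"
        using m by (auto simp: k'_def)
      have "2 ^ Suc k' * r \<le> 2 ^ Suc m * r"
        using k' r by (intro mult_right_mono power_increasing) auto
      also have "\<dots> < R"
        using m by (simp add: J1_def)
      finally have "2 ^ Suc k' * r < R" .
      moreover have "\<psi> (2 ^ Suc k * r) \<le> 2 * \<psi> (2 ^ Suc k' * r)"
        using k k' by (intro e) (auto simp: J1_def)
      ultimately have "\<Phi> (\<psi> (2 ^ Suc k * r) / l) * wmeas w (ball x (2 ^ Suc k * r)) \<le>
          ennreal (2 * C / D * \<sigma> ^ (k' - k))"
        unfolding l_def by (intro modular_layer_le r k')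
      moreover have "wmeas w (E k \<inter> ball a R) \<le> wmeas w (ball x (2 ^ Suc k * r))"
        using E(2)[of k] k by (intro wmeas_mono) (auto simp: J1_def)
      then have "mass k \<le> \<Phi> (\<psi> (2 ^ Suc k * r) / l) * wmeas w (ball x (2 ^ Suc k * r))"
        unfolding mass_def by (rule mult_left_mono) simp
      \<comment> \<open>The minimum in \<open>k'\<close> makes this power one of the two on the
        right; their sum covers both cases.\<close>
      moreover have "\<sigma> ^ (k' - k) \<le> \<sigma> ^ e k + \<sigma> ^ (m - k)"
        using \<sigma> by (auto simp: k'_def min_def)
      then have "2 * C / D * \<sigma> ^ (k' - k) \<le> 2 * C / D * (\<sigma> ^ e k + \<sigma> ^ (m - k))"
        using C D_gt(1) by (intro mult_left_mono) auto
      ultimately show ?thesis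
        by (meson ennreal_leI order.trans)
    qed
    then have "(\<Sum>k\<in>J1. mass k) \<le> (\<Sum>k\<in>J1. ennreal (2 * C / D * (\<sigma> ^ e k + \<sigma> ^ (m - k))))"
      by (rule sum_mono)
    also have "\<dots> = ennreal (\<Sum>k\<in>J1. 2 * C / D * (\<sigma> ^ e k + \<sigma> ^ (m - k)))"
      using C D_gt(1) \<sigma> by (intro sum_ennreal) auto
    also have "(\<Sum>k\<in>J1. 2 * C / D * (\<sigma> ^ e k + \<sigma> ^ (m - k))) =
        2 * C / D * ((\<Sum>k\<in>J1. \<sigma> ^ e k) + (\<Sum>k\<in>J1. \<sigma> ^ (m - k)))"
      by (simp only: sum_distrib_left[symmetric] sum.distrib)
    also have "ennreal \<dots> \<le> ennreal (2 * C / D * (1 / (1 - \<sigma>)\<^sup>2 + 1 / (1 - \<sigma>)))"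
    proof (intro ennreal_leI mult_left_mono add_mono)
      have "(\<Sum>k\<in>J1. \<sigma> ^ e k) \<le> (\<Sum>k\<in>J. \<sigma> ^ e k)"
        using J \<sigma> by (intro sum_mono2) (auto simp: J1_def)
      also have "\<dots> \<le> 1 / (1 - \<sigma>)\<^sup>2"
        by (rule sum_power_le_of_card_fibres[OF J card \<sigma>])
      finally show "(\<Sum>k\<in>J1. \<sigma> ^ e k) \<le> 1 / (1 - \<sigma>)\<^sup>2" .
      show "(\<Sum>k\<in>J1. \<sigma> ^ (m - k)) \<le> 1 / (1 - \<sigma>)"
        using fin by (intro sum_power_diff_le \<sigma>) (auto simp: m_def)
    qed (use C D_gt(1) in auto)
    finally show ?thesis .
  qed
  \<comment> \<open>All these layers share one bound for \<open>\<Phi>\<close>, so disjointness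
    suffices: inside \<open>ball a R\<close> their weights add up to at most that of the
    ball.\<close>
  have large: "(\<Sum>k\<in>J2. mass k) \<le> ennreal (1 / D)"
  proof -
    have "mass k \<le> \<Phi> (1 / D * U a R) * wmeas w (E k \<inter> ball a R)" if "k \<in> J2" for k
    proof -
      have "\<psi> (2 ^ Suc k * r) \<le> \<psi> R"
        using that r by (intro \<psi>_decreasing) (auto simp: J2_def)
      then have "\<psi> (2 ^ Suc k * r) / l \<le> \<psi> R / l"
        using l by (intro divide_right_mono) auto
      also have "\<dots> = 1 / D * U a R"
        using \<psi>_pos[OF r(2)] by (simp add: l_def)
      finally show ?thesis
        unfolding mass_def using \<psi>_pos[of "2 ^ Suc k * r"] r(1) l
        by (intro mult_right_mono young_mono[OF young]) (auto intro: less_imp_le)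
    qed
    then have "(\<Sum>k\<in>J2. mass k) \<le> (\<Sum>k\<in>J2. \<Phi> (1 / D * U a R) * wmeas w (E k \<inter> ball a R))"
      by (rule sum_mono)
    also have "\<dots> = \<Phi> (1 / D * U a R) * (\<Sum>k\<in>J2. wmeas w (E k \<inter> ball a R))"
      by (simp only: sum_distrib_left)
    also have "(\<Sum>k\<in>J2. wmeas w (E k \<inter> ball a R)) = wmeas w (\<Union>k\<in>J2. E k \<inter> ball a R)"
    proof -
      have "disjoint_family_on (\<lambda>k. E k \<inter> ball a R) J2"
        using E(3) by (auto simp: disjoint_family_on_def J2_def)
      moreover have "E k \<inter> ball a R \<in> sets lebesgue" if "k \<in> J2" for k
        using E(1)[of k] that by (auto simp: J2_def)
      moreover have "(\<Union>k\<in>J2. E k \<inter> ball a R) \<in> sets lebesgue"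
        using calculation(2) fin(2) by (intro sets.finite_UN) auto
      ultimately show ?thesis
        using fin(2) by (simp add: wmeas_eq_density[OF weight] sum_emeasure image_subset_iff del: UN_simps)
    qed
    also have "\<Phi> (1 / D * U a R) * \<dots> \<le> \<Phi> (1 / D * U a R) * wmeas w (ball a R)"
      by (intro mult_left_mono wmeas_mono) auto
    also have "\<dots> \<le> ennreal (1 / D)"
      using D_gt(1) r(2) by (intro modular_U_le) auto
    finally show ?thesis .
  qed
  have "(\<integral>\<^sup>+y. \<Phi> (norm (restr (ball a R) f y) / l) * ennreal (w y) \<partial>lebesgue) = (\<Sum>k\<in>J. mass k)"
    unfolding mass_def
  proof (rule nn_integral_modular_simple[OF young weight _ J _ E(3)])
    show "0 \<le> \<psi> (2 ^ Suc k * r)" for k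
      using \<psi>_pos[of "2 ^ Suc k * r"] r by (simp add: less_imp_le)
  qed (use E(1) f in auto)
  also have "\<dots> = (\<Sum>k\<in>J1. mass k) + (\<Sum>k\<in>J2. mass k)"
    unfolding split(1) by (rule sum.union_disjoint[OF fin split(2)])
  also have "\<dots> \<le> ennreal (2 * C / D * (1 / (1 - \<sigma>)\<^sup>2 + 1 / (1 - \<sigma>))) + ennreal (1 / D)"
    by (intro add_mono small large)
  also have "\<dots> = ennreal (1 / D + 2 * C / D * (1 / (1 - \<sigma>)\<^sup>2 + 1 / (1 - \<sigma>)))"
    using C D_gt(1) \<sigma> by (subst ennreal_plus[symmetric]) (auto simp: add.commute)
  also have "\<dots> \<le> ennreal 1"
    by (intro ennreal_leI D_gt(3))
  finally have "(\<integral>\<^sup>+y. \<Phi> (norm (restr (ball a R) f y) / l) * ennreal (w y) \<partial>lebesgue) \<le> 1"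
    by simp
  then show ?thesis
    unfolding orlicz_norm_def l_def[symmetric] using l by (intro INF_lower) auto
qed

end

subsection \<open>Lower bounds for genuine Calderon--Zygmund operators\<close>

text \<open>\<open>T\<close> acts on representatives, so homogeneity with the scalar 0 gives
  vanishing only almost everywhere.\<close>

lemma bounded_linear_L2_zero:
  assumes "bounded_linear_L2 T"
  shows "AE x in lebesgue. T (\<lambda>_. 0) x = 0"
proof -
  have "(\<lambda>_. 0) \<in> L2_space"
    by (simp add: L2_space_def)
  moreover have "\<forall>c. \<forall>f\<in>L2_space. AE x in lebesgue. T (\<lambda>y. c * f y) x = c * T f x"
    using assms by (simp add: bounded_linear_L2_def)
  ultimately have "AE x in lebesgue. T (\<lambda>y. 0 * 0) x = 0 * T (\<lambda>_. 0) x"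
    by (elim allE[of _ 0] ballE[of _ _ "\<lambda>_. 0"]) auto
  then show ?thesis
    by simp
qed

lemma weak_L1_norm_eq_0_imp_AE:
  fixes f :: "real^'n \<Rightarrow> 'a::{real_normed_field,euclidean_space}"
  assumes f: "f \<in> borel_measurable lebesgue" and "weak_L1_norm f = 0"
  shows "AE x in lebesgue. f x = 0"
proof -
  have "AE x in lebesgue. \<not> inverse (real (Suc n)) < norm (f x)" for n
  proof -
    have "ennreal (inverse (real (Suc n))) * emeasure lebesgue {x. inverse (real (Suc n)) < norm (f x)} \<le> weak_L1_norm f"
      unfolding weak_L1_norm_def by (intro SUP_upper) auto
    then have "emeasure lebesgue {x. inverse (real (Suc n)) < norm (f x)} = 0"
      using assms(2) by (auto simp del: of_nat_Suc)
    moreover have "{x \<in> space lebesgue. inverse (real (Suc n)) < norm (f x)} \<in> sets lebesgue"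
      using f by measurable
    ultimately show ?thesis
      by (intro AE_I[of _ _ "{x. inverse (real (Suc n)) < norm (f x)}"]) auto
  qed
  then have "AE x in lebesgue. \<forall>n. \<not> inverse (real (Suc n)) < norm (f x)"
    unfolding AE_all_countable by blast
  then show ?thesis
  proof eventually_elim
    case (elim x)
    show ?case
    proof (rule ccontr)
      assume "f x \<noteq> 0"
      then obtain n where "inverse (real (Suc n)) < norm (f x)"
        using reals_Archimedean[of "norm (f x)"] by auto
      then show False
        using elim by blast
    qed
  qed
qed

text \<open>The constant zero sequence approximates the zero function, so \<open>h\<close> agrees
  almost everywhere with \<open>T\<close> of zero. This removes the local part of \<open>T f\<close>
  on balls whose double misses the test function.\<close>

lemma weak11_value_zero:
  fixes T :: "(real^'n \<Rightarrow> 'a) \<Rightarrow> real^'n \<Rightarrow> 'a::{real_normed_field,euclidean_space}"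
  assumes T: "bounded_linear_L2 T" and h: "weak11_value T (\<lambda>_. 0) h"
  shows "AE x in lebesgue. h x = 0"
proof -
  have zero: "(\<lambda>_. 0) \<in> bounded_cpt" "(\<lambda>_. 0) \<in> L2_space"
    by (auto simp: bounded_cpt_def L2_space_def supp_def)
  have "T (\<lambda>_. 0) \<in> borel_measurable lebesgue" "h \<in> borel_measurable lebesgue"
    using T h zero by (auto simp: bounded_linear_L2_def L2_space_def weak11_value_def)
  then have "(\<lambda>x. T (\<lambda>_. 0) x - h x) \<in> borel_measurable lebesgue"
    by measurable
  moreover have "(\<lambda>k::nat. weak_L1_norm (\<lambda>x. T (\<lambda>_. 0) x - h x)) \<longlonglongrightarrow> 0"
    using h zero(1) unfolding weak11_value_def by (elim conjE allE[of _ "\<lambda>_ _. 0"]) auto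
  then have "weak_L1_norm (\<lambda>x. T (\<lambda>_. 0) x - h x) = 0"
    by (simp add: LIMSEQ_const_iff)
  ultimately have "AE x in lebesgue. T (\<lambda>_. 0) x - h x = 0"
    by (rule weak_L1_norm_eq_0_imp_AE)
  then show ?thesis
    using bounded_linear_L2_zero[OF T] by eventually_elim simp
qed

text \<open>\<open>v\<close> is the rotated axis of the cone. Within distance
  \<open>2 * \<delta> * t\<close> of the axial point at height \<open>3/2 * t\<close>, the axial
  coordinate exceeds \<open>t / 2\<close> while the transverse part stays below
  \<open>\<theta> * (t / 2)\<close>. The factor 2 leaves room for moving both arguments of the
  kernel, each by up to \<open>\<delta> * t\<close>.\<close>

lemma genuine_kernel_lower_bound:
  fixes K :: "real^'n \<Rightarrow> real^'n \<Rightarrow> 'a::{real_normed_field,euclidean_space}"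
  assumes "genuine_kernel K"
  obtains c \<delta> v where "0 < c" "0 < \<delta>" "\<delta> \<le> 1/2" "norm v = 1"
    "\<And>x y t. 0 < t \<Longrightarrow> norm ((x - y) - (3/2 * t) *\<^sub>R v) < 2 * \<delta> * t \<Longrightarrow>
      \<exists>b. K x y = of_real b \<and> c / norm (x - y) ^ CARD('n) \<le> b"
proof -
  obtain c \<theta> R k where c: "0 < c" and \<theta>: "0 < \<theta>" and R: "orthogonal_matrix (R :: real^'n^'n)"
    and K: "\<And>x y. x - y \<in> (\<lambda>v. R *v v) ` cone_about k \<theta> \<Longrightarrow>
      \<exists>b. K x y = of_real b \<and> c / norm (x - y) ^ CARD('n) \<le> b"
    using assms unfolding genuine_kernel_def by blast
  \<comment> \<open>The bound \<open>\<theta> / 4\<close> controls the transverse part;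
    \<open>1/2\<close> controls the axial coordinate and later keeps the balls inside their
    annuli.\<close>
  define \<delta> where "\<delta> = min (1/2) (\<theta> / 4)"
  have \<delta>: "0 < \<delta>" "\<delta> \<le> 1/2" "2 * \<delta> \<le> \<theta> / 2"
    using \<theta> by (auto simp: \<delta>_def)
  have norm_R: "norm (R *v u) = norm u" for u
  proof -
    have "orthogonal_transformation ((*v) R)"
      using R by (simp add: orthogonal_transformation_matrix)
    then show ?thesis
      by (rule orthogonal_transformation_norm)
  qed
  define v where "v = R *v axis k 1"
  have "norm v = 1"
    by (simp add: v_def norm_R)
  moreover have "x - y \<in> (\<lambda>v. R *v v) ` cone_about k \<theta>"
    if t: "0 < t" and near: "norm ((x - y) - (3/2 * t) *\<^sub>R v) < 2 * \<delta> * t" for x y t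
  proof -
    \<comment> \<open>The difference in the coordinates of the unrotated cone.\<close>
    define d where "d = transpose R *v (x - y)"
    have d: "R *v d = x - y"
      using R unfolding d_def matrix_vector_mul_assoc orthogonal_matrix_def
      by (metis matrix_vector_mul_lid)
    define z where "z = d - (3/2 * t) *\<^sub>R axis k 1"
    have "R *v z = (x - y) - (3/2 * t) *\<^sub>R v"
      by (simp add: z_def d v_def matrix_vector_mult_diff_distrib matrix_vector_mult_scaleR)
    then have z: "norm z < 2 * \<delta> * t"
      using near norm_R[of z] by simp
    have "sqrt (\<Sum>i\<in>UNIV - {k}. (d $ i)\<^sup>2) = sqrt (\<Sum>i\<in>UNIV - {k}. (z $ i)\<^sup>2)"
      by (intro arg_cong[of _ _ sqrt] sum.cong) (auto simp: z_def axis_def)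
    also have "\<dots> \<le> norm z"
      unfolding norm_vec_def L2_set_def by (intro real_sqrt_le_mono) (auto intro!: sum_mono2)
    also have "\<dots> < 2 * \<delta> * t"
      by (rule z)
    also have "\<dots> \<le> \<theta> * (t / 2)"
      using mult_right_mono[OF \<delta>(3), of t] t by simp
    also have "\<dots> \<le> \<theta> * \<bar>d $ k\<bar>"
    proof (rule mult_left_mono)
      have "\<bar>z $ k\<bar> \<le> norm z"
        by (rule component_le_norm_cart)
      also have "\<dots> < t"
        using z mult_right_mono[OF \<delta>(2), of t] t by linarith
      finally have "\<bar>d $ k - 3/2 * t\<bar> < t"
        by (simp add: z_def)
      then show "t / 2 \<le> \<bar>d $ k\<bar>"
        by linarith
    qed (use \<theta> in auto)
    finally have "d \<in> cone_about k \<theta>"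
      by (simp add: cone_about_def)
    then show ?thesis
      using d by (metis imageI)
  qed
  ultimately show ?thesis
    using that[of c \<delta> v] c \<delta> K by blast
qed

text \<open>\<open>cone_ball v \<delta> x r k\<close> sits inside the part of the dyadic annulus \<open>2 ^ k * r \<le> \<bar>y - x\<bar> < 2 ^ (k + 1) * r\<close>
  on which the kernel \<open>K z y\<close> is bounded below, uniformly for \<open>z\<close> in \<open>ball x (\<delta> * r)\<close>.\<close>

definition cone_ball :: "real^'n \<Rightarrow> real \<Rightarrow> real^'n \<Rightarrow> real \<Rightarrow> nat \<Rightarrow> (real^'n) set" where
  "cone_ball v \<delta> x r k = ball (x - (3/2 * (2 ^ k * r)) *\<^sub>R v) (\<delta> * (2 ^ k * r))"

lemma dist_cone_ball:
  assumes "norm v = 1" "0 < \<delta>" "\<delta> \<le> 1/2" "0 < r" "y \<in> cone_ball v \<delta> x r k"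
  shows "2 ^ k * r < dist x y" "dist x y < 2 ^ Suc k * r"
proof -
  define t where "t = 2 ^ k * r"
  have t: "t > 0"
    using assms by (simp add: t_def)
  define c where "c = x - (3/2 * t) *\<^sub>R v"
  have "dist x c = 3/2 * t"
    using assms t by (simp add: c_def dist_norm)
  moreover have "dist c y < \<delta> * t"
    using assms by (simp add: cone_ball_def c_def t_def)
  moreover have "\<delta> * t \<le> 1/2 * t"
    using assms t by (intro mult_right_mono) auto
  ultimately have "t < dist x y" "dist x y < 2 * t"
    using dist_triangle[of x c y] dist_triangle[of x y c] by (simp_all add: dist_commute)
  then show "2 ^ k * r < dist x y" "dist x y < 2 ^ Suc k * r"
    by (simp_all add: t_def)
qed

lemma cone_ball_subset:
  assumes "norm v = 1" "0 < \<delta>" "\<delta> \<le> 1/2" "0 < r"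
  shows "cone_ball v \<delta> x r k \<subseteq> ball x (2 ^ Suc k * r)"
  using dist_cone_ball[OF assms] by auto

lemma disjoint_cone_balls:
  assumes "norm v = 1" "0 < \<delta>" "\<delta> \<le> 1/2" "0 < r"
  shows "disjoint_family_on (cone_ball v \<delta> x r) J"
proof -
  have False if "y \<in> cone_ball v \<delta> x r j" "y \<in> cone_ball v \<delta> x r k" "j < k" for y j k
  proof -
    have "(2::real) ^ Suc j * r \<le> 2 ^ k * r"
      using that assms by (intro mult_right_mono power_increasing) auto
    then show False
      using dist_cone_ball(2)[OF assms that(1)] dist_cone_ball(1)[OF assms that(2)] by linarith
  qed
  then show ?thesis
    unfolding disjoint_family_on_def by (metis disjoint_iff linorder_neqE_nat)
qed

lemma measure_cone_ball:
  fixes v x :: "real^'n"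
  assumes "0 < \<delta>" "0 < r"
  shows "measure lebesgue (cone_ball v \<delta> x r k) =
    unit_ball_vol (real CARD('n)) * (\<delta> * (2 ^ k * r)) ^ CARD('n)"
  using assms content_ball[of "\<delta> * (2 ^ k * r)" "x - (3/2 * (2 ^ k * r)) *\<^sub>R v"]
  by (simp add: cone_ball_def)

text \<open>The test function vanishes on the doubled ball, so there \<open>T f\<close> is a pure
  kernel integral, and its integrand is a nonnegative real: nothing cancels. On layer
  \<open>k\<close> the distance of the arguments is at most \<open>4 * (2 ^ k * r)\<close>, so the
  kernel bound times the volume of the layer does not depend on \<open>k\<close>; this gives the
  factor \<open>(\<delta> / 4) ^ CARD('n)\<close>.\<close>

lemma CZ_value_layers_ge:
  fixes T :: "(real^'n \<Rightarrow> 'a) \<Rightarrow> real^'n \<Rightarrow> 'a::{real_normed_field,euclidean_space}"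
    and v :: "real^'n"
  assumes T: "bounded_linear_L2 T" and v: "norm v = 1" and \<delta>: "0 < \<delta>" "\<delta> \<le> 1/2" and r: "0 < r"
    and c: "0 < c" and K: "\<And>x y t. 0 < t \<Longrightarrow> norm ((x - y) - (3/2 * t) *\<^sub>R v) < 2 * \<delta> * t \<Longrightarrow>
      \<exists>b. K x y = of_real b \<and> c / norm (x - y) ^ CARD('n) \<le> b"
    and J: "finite J" and \<alpha>: "\<And>k. 0 \<le> \<alpha> k"
    and f: "\<And>y. f y = of_real (\<Sum>k\<in>J. \<alpha> k * indicator (cone_ball v \<delta> x\<^sub>0 r k) y)"
    and g: "CZ_value T K f g"
  shows "AE x in lebesgue. x \<in> ball x\<^sub>0 (\<delta> * r) \<longrightarrow>
    c * unit_ball_vol (real CARD('n)) * (\<delta> / 4) ^ CARD('n) * (\<Sum>k\<in>J. \<alpha> k) \<le> norm (g x)"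
proof -
  define E where "E = cone_ball v \<delta> x\<^sub>0 r"
  note dist_E = dist_cone_ball[OF v \<delta> r, of _ x\<^sub>0, folded E_def]
  note disj = disjoint_cone_balls[OF v \<delta> r, of x\<^sub>0, folded E_def]
  have f: "f y = of_real (\<Sum>k\<in>J. \<alpha> k * indicator (E k) y)" for y
    using f by (simp add: E_def)
  have f_on: "f y = of_real (\<alpha> k)" if "k \<in> J" "y \<in> E k" for k y
  proof -
    have "y \<notin> E j" if "j \<in> J - {k}" for j
      using disj[of J] \<open>k \<in> J\<close> \<open>y \<in> E k\<close> that by (auto simp: disjoint_family_on_def)
    then show ?thesis
      using that by (simp add: f sum.remove[OF J \<open>k \<in> J\<close>] sum.neutral)
  qed
  have f_off: "f y = 0" if "\<And>k. k \<in> J \<Longrightarrow> y \<notin> E k" for y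
    using that by (simp add: f sum.neutral)
  have f_ball: "f y = 0" if "y \<in> ball x\<^sub>0 (2 * (\<delta> * r))" for y
  proof (rule f_off)
    fix k
    have "2 * \<delta> * r \<le> 1 * r"
      using \<delta> r by (intro mult_right_mono) auto
    also have "1 * r \<le> 2 ^ k * r"
      using r by (intro mult_right_mono) auto
    finally show "y \<notin> E k"
      using that dist_E(1)[of y k] by auto
  qed
  have "0 < \<delta> * r"
    using \<delta> r by simp
  then obtain h where h: "weak11_value T (restr (ball x\<^sub>0 (2 * (\<delta> * r))) f) h"
    and gh: "AE x in lebesgue. x \<in> ball x\<^sub>0 (\<delta> * r) \<longrightarrow>
       set_integrable lebesgue (- ball x\<^sub>0 (2 * (\<delta> * r))) (\<lambda>y. K x y * f y) \<and>
       g x = h x + set_lebesgue_integral lebesgue (- ball x\<^sub>0 (2 * (\<delta> * r))) (\<lambda>y. K x y * f y)"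
    using g unfolding CZ_value_def by blast
  have "restr (ball x\<^sub>0 (2 * (\<delta> * r))) f = (\<lambda>_. 0)"
    using f_ball by (auto simp: restr_def indicator_def fun_eq_iff)
  then have "AE x in lebesgue. h x = 0"
    using weak11_value_zero[OF T] h by simp
  with gh show ?thesis
  proof eventually_elim
    case (elim x)
    show ?case
    proof
      assume x: "x \<in> ball x\<^sub>0 (\<delta> * r)"
      define F where "F y = K x y * f y" for y
      have restrict: "indicator (- ball x\<^sub>0 (2 * (\<delta> * r))) y *\<^sub>R (K x y * f y) = F y" for y
        using f_ball[of y] by (auto simp: F_def indicator_def)
      have F: "integrable lebesgue F" and gx: "g x = (\<integral>y. F y \<partial>lebesgue)"
        using elim x unfolding set_integrable_def set_lebesgue_integral_def restrict by simp_all
      define low where "low k = \<alpha> k * (c / (4 * (2 ^ k * r)) ^ CARD('n))" for k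
      have F_on: "\<exists>b. F y = of_real b \<and> low k \<le> b"
        if k: "k \<in> J" "y \<in> E k" for k y
      proof -
        define t where "t = 2 ^ k * r"
        have t: "0 < t" "r \<le> t"
          using r by (auto simp: t_def)
        define u where "u = (3/2 * t) *\<^sub>R v"
        define z where "z = (x - y) - u"
        \<comment> \<open>The two errors are the distance of \<open>x\<close> from its centre, below
          \<open>\<delta> * r\<close>, and that of \<open>y\<close> from the centre of its layer,
          below \<open>\<delta> * t\<close>.\<close>
        have "norm z \<le> dist x\<^sub>0 x + dist (x\<^sub>0 - u) y"
          unfolding z_def dist_norm by norm
        also have "\<dots> < \<delta> * r + \<delta> * t"
          using x k by (intro add_strict_mono) (auto simp: E_def cone_ball_def t_def u_def)
        also have "\<dots> \<le> 2 * \<delta> * t"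
          using \<delta> t mult_left_mono[of r t \<delta>] by simp
        finally have z: "norm z < 2 * \<delta> * t" .
        then obtain b where b: "K x y = of_real b" "c / norm (x - y) ^ CARD('n) \<le> b"
          using K[OF t(1), of x y] by (auto simp: z_def u_def)
        have "2 * \<delta> * t \<le> t"
          using \<delta> t by simp
        then have z': "norm z < t"
          using z by linarith
        have "norm u = 3/2 * t"
          using v t by (simp add: u_def)
        moreover have "norm u \<le> norm (x - y) + norm z" "norm (x - y) \<le> norm z + norm u"
          unfolding z_def by norm+
        ultimately have "0 < norm (x - y)" "norm (x - y) \<le> 4 * t"
          using z' t by linarith+
        then have "c / (4 * t) ^ CARD('n) \<le> c / norm (x - y) ^ CARD('n)"
          using c t by (intro divide_left_mono power_mono mult_pos_pos zero_less_power) auto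
        with b have "\<alpha> k * (c / (4 * t) ^ CARD('n)) \<le> \<alpha> k * b"
          by (intro mult_left_mono \<alpha>) auto
        moreover have "F y = of_real (\<alpha> k * b)"
          using b f_on[OF k] by (simp add: F_def)
        ultimately show ?thesis
          unfolding low_def t_def by blast
      qed
      have low_nonneg: "0 \<le> low k" for k
        using \<alpha>[of k] c r by (simp add: low_def)
      have F_norm: "F y = of_real (norm (F y)) \<and>
        (\<Sum>k\<in>J. low k * indicator (E k) y) \<le> norm (F y)" for y
      proof (cases "\<exists>k\<in>J. y \<in> E k")
        case True
        then obtain k where k: "k \<in> J" "y \<in> E k" by blast
        obtain b where b: "F y = of_real b" "low k \<le> b"
          using F_on[OF k] by blast
        have "y \<notin> E j" if "j \<in> J - {k}" for j
          using disj[of J] k that by (auto simp: disjoint_family_on_def)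
        then have "(\<Sum>k\<in>J. low k * indicator (E k) y) =
            low k"
          using k by (simp add: sum.remove[OF J k(1)] sum.neutral)
        moreover have "0 \<le> b"
          using b(2) low_nonneg[of k] by linarith
        ultimately show ?thesis
          using b by simp
      next
        case False
        then have "F y = 0"
          using f_off[of y] by (simp add: F_def)
        then show ?thesis
          using False by (simp add: sum.neutral)
      qed
      have "E k \<in> lmeasurable" for k
        by (simp add: E_def cone_ball_def)
      then have low_int: "integrable lebesgue (\<lambda>y. low k * indicator (E k) y)" for k
        unfolding fmeasurable_def by (intro integrable_mult_right integrable_real_indicator) blast+
      have "c * unit_ball_vol (real CARD('n)) * (\<delta> / 4) ^ CARD('n) * (\<Sum>k\<in>J. \<alpha> k) =
          (\<Sum>k\<in>J. low k * measure lebesgue (E k))"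
        unfolding sum_distrib_left
      proof (rule sum.cong[OF refl])
        fix k
        define P Q where "P = (\<delta> * (2 ^ k * r)) ^ CARD('n)" and "Q = (4 * (2 ^ k * r)) ^ CARD('n)"
        have "(\<delta> / 4) ^ CARD('n) = P / Q"
          using r unfolding P_def Q_def power_divide[symmetric] by simp
        then show "c * unit_ball_vol (real CARD('n)) * (\<delta> / 4) ^ CARD('n) * \<alpha> k =
            low k * measure lebesgue (E k)"
          unfolding low_def E_def measure_cone_ball[OF \<delta>(1) r] P_def[symmetric] Q_def[symmetric]
          by (simp add: mult_ac)
      qed
      also have "\<dots> = (\<integral>y. (\<Sum>k\<in>J. low k * indicator (E k) y) \<partial>lebesgue)"
        using low_int by (subst Bochner_Integration.integral_sum) auto
      also have "\<dots> \<le> (\<integral>y. norm (F y) \<partial>lebesgue)"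
        using low_int F F_norm by (intro integral_mono Bochner_Integration.integrable_sum integrable_norm) auto
      also have "\<dots> = norm (g x)"
      proof -
        have "g x = (\<integral>y. norm (F y) *\<^sub>R (1::'a) \<partial>lebesgue)"
          unfolding gx using F_norm by (intro Bochner_Integration.integral_cong refl) (simp add: of_real_def)
        also have "\<dots> = (\<integral>y. norm (F y) \<partial>lebesgue) *\<^sub>R 1"
          using F by (intro integral_scaleR_left) auto
        finally show ?thesis
          by (simp add: integral_nonneg_AE)
      qed
      finally show "c * unit_ball_vol (real CARD('n)) * (\<delta> / 4) ^ CARD('n) * (\<Sum>k\<in>J. \<alpha> k) \<le> norm (g x)" .
    qed
  qed
qed

subsection \<open>The integral condition\<close>

text \<open>Up to \<open>2 * r\<close> the integrand is at most \<open>\<psi> s / s\<close>. Beyond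
  it, each dyadic interval has length equal to its left endpoint, so it contributes at most the
  value of \<open>\<psi>\<close> there.\<close>

lemma nn_integral_dyadic_le:
  fixes \<psi> :: "real \<Rightarrow> real"
  assumes s: "0 < s" "s \<le> r" and pos: "\<And>t. 0 < t \<Longrightarrow> 0 \<le> \<psi> t"
    and dec: "\<And>t u. 0 < t \<Longrightarrow> t \<le> u \<Longrightarrow> \<psi> u \<le> \<psi> t"
    and B: "\<And>N. (\<Sum>k<N. \<psi> (2 ^ Suc k * r)) \<le> B"
  shows "(\<integral>\<^sup>+t\<in>{s<..}. ennreal (\<psi> t / t) \<partial>lebesgue) \<le> ennreal (\<psi> s * (2 * r / s) + B)"
proof -
  define \<rho> where "\<rho> k = 2 ^ Suc k * r" for k
  have \<rho>: "0 < \<rho> k" for k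
    using s by (simp add: \<rho>_def)
  define I where "I k t = ennreal (\<psi> (\<rho> k) / \<rho> k) * indicator {\<rho> k<..2 * \<rho> k} t" for k t
  have le: "ennreal (\<psi> t / t) * indicator {s<..} t \<le>
      ennreal (\<psi> s / s) * indicator {s<..2 * r} t + (\<Sum>k. I k t)" for t
  proof -
    consider "t \<le> s" | "s < t" "t \<le> 2 * r" | "2 * r < t"
      by linarith
    then show ?thesis
    proof cases
      case 2
      then have "\<psi> t / t \<le> \<psi> s / s"
        using s pos dec by (intro frac_le) auto
      then have "ennreal (\<psi> t / t) * indicator {s<..} t \<le> ennreal (\<psi> s / s) * indicator {s<..2 * r} t"
        using 2 by (simp add: ennreal_leI)
      then show ?thesis
        by (rule order.trans) simp
    next
      case 3
      obtain n where "t / r < 2 ^ n"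
        using real_arch_pow[of 2 "t / r"] by auto
      then have "t \<le> 2 ^ n * r"
        using s by (simp add: field_simps)
      also have "\<dots> \<le> 2 * \<rho> n"
        using s by (simp add: \<rho>_def)
      finally have ex: "t \<le> 2 * \<rho> n" .
      \<comment> \<open>The interval containing \<open>t\<close>: minimality gives
        \<open>\<rho> k < t\<close>, since \<open>2 * \<rho> j\<close> equals
        \<open>\<rho> (Suc j)\<close>; for \<open>k = 0\<close> this is the case assumption.\<close>
      define k where "k = (LEAST k. t \<le> 2 * \<rho> k)"
      have k: "t \<le> 2 * \<rho> k"
        unfolding k_def using ex by (rule LeastI)
      have "\<rho> k < t"
      proof (cases k)
        case 0
        then show ?thesis
          using 3 by (simp add: \<rho>_def)
      next
        case (Suc j)
        then have "\<not> t \<le> 2 * \<rho> j"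
          using not_less_Least[of j "\<lambda>k. t \<le> 2 * \<rho> k"] by (simp add: k_def)
        then show ?thesis
          using Suc by (simp add: \<rho>_def)
      qed
      then have "\<psi> t / t \<le> \<psi> (\<rho> k) / \<rho> k"
        using \<rho>[of k] pos dec by (intro frac_le) auto
      then have "ennreal (\<psi> t / t) * indicator {s<..} t \<le> I k t"
        using 3 k \<open>\<rho> k < t\<close> s by (simp add: I_def ennreal_leI)
      also have "I k t \<le> (\<Sum>k. I k t)"
        using sum_le_suminf[of "\<lambda>k. I k t" "{k}"] by auto
      finally show ?thesis
        by (rule order.trans) simp
    qed simp
  qed
  have ind [measurable]: "(\<lambda>t. ennreal b * indicator {x<..y} t) \<in> borel_measurable lebesgue" for b x y :: real
    by (intro borel_measurable_times_ennreal borel_measurable_indicator) auto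
  from le have "(\<integral>\<^sup>+t\<in>{s<..}. ennreal (\<psi> t / t) \<partial>lebesgue) \<le>
      (\<integral>\<^sup>+t. ennreal (\<psi> s / s) * indicator {s<..2 * r} t + (\<Sum>k. I k t) \<partial>lebesgue)"
    by (rule nn_integral_mono)
  also have "\<dots> = (\<integral>\<^sup>+t. ennreal (\<psi> s / s) * indicator {s<..2 * r} t \<partial>lebesgue) + (\<integral>\<^sup>+t. (\<Sum>k. I k t) \<partial>lebesgue)"
    unfolding I_def by (intro nn_integral_add) measurable
  also have "(\<integral>\<^sup>+t. ennreal (\<psi> s / s) * indicator {s<..2 * r} t \<partial>lebesgue) \<le> ennreal (\<psi> s * (2 * r / s))"
  proof -
    have "(\<integral>\<^sup>+t. ennreal (\<psi> s / s) * indicator {s<..2 * r} t \<partial>lebesgue) = ennreal (\<psi> s / s) * ennreal (2 * r - s)"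
      using s by (subst nn_integral_cmult_indicator) auto
    also have "\<dots> = ennreal (\<psi> s / s * (2 * r - s))"
      using s pos[of s] by (subst ennreal_mult') auto
    also have "\<dots> \<le> ennreal (\<psi> s / s * (2 * r))"
      using s pos[of s] by (intro ennreal_leI mult_left_mono) auto
    finally show ?thesis
      by simp
  qed
  also have "(\<integral>\<^sup>+t. (\<Sum>k. I k t) \<partial>lebesgue) = (\<Sum>k. \<integral>\<^sup>+t. I k t \<partial>lebesgue)"
    unfolding I_def by (intro nn_integral_suminf) measurable
  also have "(\<lambda>k. \<integral>\<^sup>+t. I k t \<partial>lebesgue) = (\<lambda>k. ennreal (\<psi> (\<rho> k)))"
  proof
    fix k
    have "(\<integral>\<^sup>+t. I k t \<partial>lebesgue) = ennreal (\<psi> (\<rho> k) / \<rho> k) * ennreal (\<rho> k)"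
      unfolding I_def using \<rho>[of k] by (subst nn_integral_cmult_indicator) auto
    also have "\<dots> = ennreal (\<psi> (\<rho> k) / \<rho> k * \<rho> k)"
      using \<rho>[of k] pos[of "\<rho> k"] by (subst ennreal_mult') auto
    finally show "(\<integral>\<^sup>+t. I k t \<partial>lebesgue) = ennreal (\<psi> (\<rho> k))"
      using \<rho>[of k] by simp
  qed
  also have "(\<Sum>k. ennreal (\<psi> (\<rho> k))) \<le> ennreal B"
    unfolding suminf_eq_SUP
  proof (rule SUP_least)
    fix N
    have "(\<Sum>k<N. ennreal (\<psi> (\<rho> k))) = ennreal (\<Sum>k<N. \<psi> (\<rho> k))"
      using pos \<rho> by (intro sum_ennreal) auto
    also have "\<dots> \<le> ennreal B"
      using B[of N] by (intro ennreal_leI) (simp add: \<rho>_def)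
    finally show "(\<Sum>k<N. ennreal (\<psi> (\<rho> k))) \<le> ennreal B" .
  qed
  also have "ennreal (\<psi> s * (2 * r / s)) + ennreal B = ennreal (\<psi> s * (2 * r / s) + B)"
    using B[of 0] s pos[of s] by (intro ennreal_plus[symmetric]) auto
  finally show ?thesis
    by (simp add: add_left_mono add_right_mono)
qed

section \<open>Morrey bounds for the test functions and their consequence for dyadic sums\<close>

context orlicz_ball_growth
begin

text \<open>The factor \<open>U a R\<close> of the Morrey norm cancels against the Orlicz bound, and
  \<open>\<psi> R \<le> \<phi> a R\<close> leaves \<open>D\<close>, independent of the centre, the
  radius and the number of layers.\<close>

lemma morrey_norm_layers_le:
  fixes f :: "real^'n \<Rightarrow> 'a::{real_normed_field,euclidean_space}"
  assumes r: "0 < r" and J: "finite J"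
    and E: "\<And>k. k \<in> J \<Longrightarrow> E k \<in> sets lebesgue" "\<And>k. k \<in> J \<Longrightarrow> E k \<subseteq> ball x (2 ^ Suc k * r)"
      "disjoint_family_on E J"
    and e: "\<And>k l. k \<in> J \<Longrightarrow> k \<le> l \<Longrightarrow> l \<le> k + e k \<Longrightarrow> \<psi> (2 ^ Suc k * r) \<le> 2 * \<psi> (2 ^ Suc l * r)"
    and card: "\<And>d. card {k \<in> J. e k = d} \<le> Suc d"
    and f: "\<And>y. f y = of_real (\<Sum>k\<in>J. \<psi> (2 ^ Suc k * r) * indicator (E k) y)"
    and \<phi>: "\<And>a R. 0 < R \<Longrightarrow> \<psi> R \<le> \<phi> a R"
  shows "f \<in> morrey_space \<Phi> \<phi> w" "morrey_norm \<Phi> \<phi> w f \<le> ennreal D"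
proof -
  have orlicz: "orlicz_norm \<Phi> w (restr (ball a R) f) \<le> ennreal (D * \<psi> R / U a R)" if "0 < R" for a R
    by (rule orlicz_norm_layers_le[OF r that J E e card f])
  show le: "morrey_norm \<Phi> \<phi> w f \<le> ennreal D"
    unfolding morrey_norm_def
  proof (clarsimp intro!: SUP_least)
    fix a :: "real^'n" and R :: real
    assume R: "0 < R"
    have \<phi>_pos: "0 < \<phi> a R"
      using \<phi>[OF R, of a] \<psi>_pos[OF R] by linarith
    have "inverse (ennreal (\<phi> a R)) * young_inv \<Phi> (inverse (wmeas w (ball a R))) *
        orlicz_norm \<Phi> w (restr (ball a R) f) \<le>
      inverse (ennreal (\<phi> a R)) * ennreal (U a R) * ennreal (D * \<psi> R / U a R)"
      unfolding ennreal_U[OF R] by (intro mult_left_mono orlicz R) auto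
    also have "\<dots> = ennreal (inverse (\<phi> a R) * U a R * (D * \<psi> R / U a R))"
      using \<phi>_pos U_pos[OF R, of a] by (simp add: inverse_ennreal ennreal_mult'[symmetric])
    also have "inverse (\<phi> a R) * U a R * (D * \<psi> R / U a R) = D * (\<psi> R / \<phi> a R)"
      using U_pos[OF R, of a] by (simp add: field_simps)
    also have "ennreal \<dots> \<le> ennreal (D * 1)"
      using \<phi>[OF R, of a] \<phi>_pos D_gt(1) by (intro ennreal_leI mult_left_mono) auto
    finally show "inverse (ennreal (\<phi> a R)) * young_inv \<Phi> (inverse (wmeas w (ball a R))) *
        orlicz_norm \<Phi> w (restr (ball a R) f) \<le> ennreal D"
      by simp
  qed
  have "f \<in> borel_measurable lebesgue"
  proof -
    have "(\<lambda>y. \<Sum>k\<in>J. \<psi> (2 ^ Suc k * r) * indicator (E k) y) \<in> borel_measurable lebesgue"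
      using E(1) by (intro borel_measurable_sum borel_measurable_times borel_measurable_indicator) auto
    then have "(\<lambda>y. of_real (\<Sum>k\<in>J. \<psi> (2 ^ Suc k * r) * indicator (E k) y) :: 'a) \<in> borel_measurable lebesgue"
      by measurable
    moreover have "f = (\<lambda>y. of_real (\<Sum>k\<in>J. \<psi> (2 ^ Suc k * r) * indicator (E k) y))"
      using f by (rule ext)
    ultimately show ?thesis
      by (simp only:)
  qed
  then show "f \<in> morrey_space \<Phi> \<phi> w"
    unfolding morrey_space_def orlicz_loc_def
    using le order.strict_trans1[OF orlicz ennreal_less_top] order.strict_trans1[OF le ennreal_less_top]
    by auto
qed

text \<open>\<open>T\<close> is applied to the selected layers and tested on
  \<open>ball x (\<delta> * r)\<close>. There the weak norm is at least the pointwise lower bound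
  divided by \<open>U\<close>, which cancels against the Morrey factor; the selected sum is thus at
  most a constant times \<open>\<phi>2\<close>. \<open>A\<close> does not depend on
  \<open>N\<close>, so the full series is controlled as well.\<close>

lemma dyadic_sum_bound:
  fixes T :: "(real^'n \<Rightarrow> 'a) \<Rightarrow> real^'n \<Rightarrow> 'a::{real_normed_field,euclidean_space}"
  assumes T: "calderon_zygmund T K" and K: "genuine_kernel K"
    and bounded: "CZ_bounded_morrey T K \<Phi> w \<phi>1 \<phi>2"
    and \<phi>1: "\<And>a R. 0 < R \<Longrightarrow> \<psi> R \<le> \<phi>1 a R" and \<phi>2: "\<And>a R. 0 < R \<Longrightarrow> 0 < \<phi>2 a R"
  obtains A \<delta> where "0 < A" "0 < \<delta>" "\<delta> \<le> 1"
    "\<And>x r N. 0 < r \<Longrightarrow> (\<Sum>k<N. \<psi> (2 ^ Suc k * r)) \<le> A * \<phi>2 x (\<delta> * r)"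
proof -
  obtain c \<delta> v where c: "0 < c" and \<delta>: "0 < \<delta>" "\<delta> \<le> 1/2" and v: "norm v = 1"
    and K: "\<And>x y t. 0 < t \<Longrightarrow> norm ((x - y) - (3/2 * t) *\<^sub>R v) < 2 * \<delta> * t \<Longrightarrow>
      \<exists>b. K x y = of_real b \<and> c / norm (x - y) ^ CARD('n) \<le> b"
    using genuine_kernel_lower_bound[OF K] by blast
  obtain M where M: "0 < M" and TM: "\<And>f. f \<in> morrey_space \<Phi> \<phi>1 w \<Longrightarrow> \<exists>g\<in>weak_morrey_space \<Phi> \<phi>2 w.
      CZ_value T K f g \<and> weak_morrey_norm \<Phi> \<phi>2 w g \<le> ennreal M * morrey_norm \<Phi> \<phi>1 w f"
    using bounded unfolding CZ_bounded_morrey_def by blast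
  have T: "bounded_linear_L2 T"
    using T by (simp add: calderon_zygmund_def)
  define \<kappa> where "\<kappa> = c * unit_ball_vol (real CARD('n)) * (\<delta> / 4) ^ CARD('n)"
  have \<kappa>: "0 < \<kappa>"
    using c \<delta> by (simp add: \<kappa>_def)
  have "(\<Sum>k<N. \<psi> (2 ^ Suc k * r)) \<le> 2 * M * D / \<kappa> * \<phi>2 x (\<delta> * r)" if r: "0 < r" for x r N
  proof -
    \<comment> \<open>Heights are taken at the outer radius: the growth condition then applies to
      the ball containing the layer, and layers reaching radius \<open>R\<close> are no higher than
      \<open>\<psi> R\<close>.\<close>
    define \<alpha> where "\<alpha> k = \<psi> (2 ^ Suc k * r)" for k
    have \<alpha>: "0 \<le> \<alpha> k" for k
      using \<psi>_pos[of "2 ^ Suc k * r"] r by (simp add: \<alpha>_def less_imp_le)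
    have \<alpha>_dec: "\<alpha> l \<le> \<alpha> k" if "k \<le> l" for k l
      unfolding \<alpha>_def using that r by (intro \<psi>_decreasing mult_right_mono power_increasing) auto
    obtain J e where J: "J \<subseteq> {..<N}" and J_sum: "(\<Sum>k<N. \<alpha> k) \<le> 2 * (\<Sum>k\<in>J. \<alpha> k)"
      and e: "\<forall>k\<in>J. \<forall>l. k \<le> l \<longrightarrow> l \<le> k + e k \<longrightarrow> \<alpha> k \<le> 2 * \<alpha> l"
      and card: "\<forall>d. card {k \<in> J. e k = d} \<le> Suc d"
      using sparse_selection[of \<alpha> N, OF \<alpha> \<alpha>_dec] by blast
    have fin: "finite J"
      using J finite_subset by blast
    define f :: "real^'n \<Rightarrow> 'a" where
      "f y = of_real (\<Sum>k\<in>J. \<alpha> k * indicator (cone_ball v \<delta> x r k) y)" for y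
    have sets: "cone_ball v \<delta> x r k \<in> sets lebesgue" for k
      by (simp add: cone_ball_def)
    have f: "f \<in> morrey_space \<Phi> \<phi>1 w" "morrey_norm \<Phi> \<phi>1 w f \<le> ennreal D"
      using morrey_norm_layers_le[OF r fin, of "cone_ball v \<delta> x r" x e f \<phi>1]
        sets cone_ball_subset[OF v \<delta> r] disjoint_cone_balls[OF v \<delta> r] e card \<phi>1
      unfolding \<alpha>_def f_def by blast+
    obtain g where g: "CZ_value T K f g" "weak_morrey_norm \<Phi> \<phi>2 w g \<le> ennreal M * morrey_norm \<Phi> \<phi>1 w f"
      using TM[OF f(1)] by blast
    define S where "S = \<kappa> * (\<Sum>k\<in>J. \<alpha> k)"
    have S0: "0 \<le> S"
      using \<kappa> \<alpha> by (simp add: S_def sum_nonneg)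
    define s where "s = \<delta> * r"
    have s: "0 < s"
      using \<delta> r by (simp add: s_def)
    have "AE y in lebesgue. y \<in> ball x s \<longrightarrow> S \<le> norm (g y)"
      unfolding S_def \<kappa>_def s_def
      by (rule CZ_value_layers_ge[OF T v \<delta> r c K fin \<alpha> _ g(1)]) (simp_all add: f_def)
    then have "ennreal (S / U x s) \<le> weak_orlicz_norm \<Phi> w (restr (ball x s) g)"
      by (rule weak_orlicz_norm_ge[OF s])
    then have "inverse (ennreal (\<phi>2 x s)) * ennreal (U x s) * ennreal (S / U x s) \<le>
        inverse (ennreal (\<phi>2 x s)) * young_inv \<Phi> (inverse (wmeas w (ball x s))) *
        weak_orlicz_norm \<Phi> w (restr (ball x s) g)"
      unfolding ennreal_U[OF s] by (intro mult_left_mono) auto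
    also have "\<dots> \<le> weak_morrey_norm \<Phi> \<phi>2 w g"
      unfolding weak_morrey_norm_def using s by (intro SUP_upper2[of "(x, s)"]) auto
    also have "\<dots> \<le> ennreal M * ennreal D"
      using g(2) f(2) by (meson mult_left_mono order.trans zero_le)
    finally have "inverse (ennreal (\<phi>2 x s)) * ennreal (U x s) * ennreal (S / U x s) \<le> ennreal M * ennreal D" .
    then have "ennreal (inverse (\<phi>2 x s) * U x s * (S / U x s)) \<le> ennreal (M * D)"
      using \<phi>2[OF s, of x] U_pos[OF s, of x] S0 M
      by (simp add: inverse_ennreal ennreal_mult'[symmetric])
    then have "inverse (\<phi>2 x s) * U x s * (S / U x s) \<le> M * D"
      using M D_gt(1) by (subst (asm) ennreal_le_iff) auto
    then have "S \<le> M * D * \<phi>2 x s"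
      using \<phi>2[OF s, of x] U_pos[OF s, of x] by (simp add: field_simps)
    then have "2 * (\<Sum>k\<in>J. \<alpha> k) \<le> 2 * M * D / \<kappa> * \<phi>2 x s"
      using \<kappa> by (simp add: S_def field_simps)
    with J_sum show ?thesis
      by (simp add: \<alpha>_def s_def)
  qed
  then show ?thesis
    using that[of "2 * M * D / \<kappa>" \<delta>] M D_gt(1) \<kappa> \<delta> by auto
qed

end

section \<open>Reduction to a decreasing radial function, and the conclusion\<close>

text \<open>Comparing balls of equal radius shows that a function in \<open>G_class\<close> depends on the centre only up to
  a constant factor.\<close>

definition radial_inf :: "(real^'n \<Rightarrow> real \<Rightarrow> real) \<Rightarrow> real \<Rightarrow> real" where
  "radial_inf \<phi> r = Inf {\<phi> a s |a s. 0 < s \<and> s \<le> r}"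

text \<open>Taking the infimum over all smaller radii as well as all centres makes the function
  truly decreasing. Almost monotonicity of \<open>\<phi>\<close> says that
  \<open>\<phi> a r / C\<close> is a lower bound of the set, which gives both comparability and
  positivity.\<close>

lemma radial_inf_bounds:
  fixes \<phi> :: "real^'n \<Rightarrow> real \<Rightarrow> real"
  assumes pos: "\<And>a r. 0 < r \<Longrightarrow> 0 < \<phi> a r" and C: "0 < C"
    and almost_dec: "\<And>a r a0 r0. 0 < r \<Longrightarrow> r \<le> r0 \<Longrightarrow> \<phi> a0 r0 \<le> C * \<phi> a r"
    and r: "0 < r"
  shows "radial_inf \<phi> r \<le> \<phi> a r" "\<phi> a r \<le> C * radial_inf \<phi> r" "0 < radial_inf \<phi> r"
    "r \<le> s \<Longrightarrow> radial_inf \<phi> s \<le> radial_inf \<phi> r"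
proof -
  have bdd: "bdd_below {\<phi> a s |a s. 0 < s \<and> s \<le> r}" for r
    using pos by (intro bdd_belowI[of _ 0]) (auto intro: less_imp_le)
  show "radial_inf \<phi> r \<le> \<phi> a r"
    unfolding radial_inf_def using r by (intro cInf_lower bdd) auto
  have "\<phi> a r / C \<le> radial_inf \<phi> r" for a
    unfolding radial_inf_def
  proof (rule cInf_greatest)
    show "{\<phi> a s |a s. 0 < s \<and> s \<le> r} \<noteq> {}"
      using r by blast
  next
    fix y assume "y \<in> {\<phi> a s |a s. 0 < s \<and> s \<le> r}"
    then obtain b s where "y = \<phi> b s" "0 < s" "s \<le> r"
      by blast
    then show "\<phi> a r / C \<le> y"
      using almost_dec[of s r a b] C by (simp add: field_simps)
  qed
  then show "\<phi> a r \<le> C * radial_inf \<phi> r" "0 < radial_inf \<phi> r"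
    using C pos[OF r, of a] by (auto simp: field_simps intro: less_le_trans[of 0 "\<phi> a r / C"])
  show "radial_inf \<phi> s \<le> radial_inf \<phi> r" if "r \<le> s"
    unfolding radial_inf_def using r that by (intro cInf_superset_mono bdd) (auto intro: order.trans)
qed

theorem theorem4p23:
  fixes \<Phi> :: "real \<Rightarrow> ennreal"
    and w :: "real^'n \<Rightarrow> real"
    and \<phi>1 \<phi>2 :: "real^'n \<Rightarrow> real \<Rightarrow> real"
    and T :: "(real^'n \<Rightarrow> 'a::{real_normed_field,euclidean_space}) \<Rightarrow> real^'n \<Rightarrow> 'a"
    and K :: "real^'n \<Rightarrow> real^'n \<Rightarrow> 'a"
  assumes "young_function \<Phi>"
    and "w \<in> Muckenhoupt_A (lower_index \<Phi>)"
    and "positive_measurable \<phi>1" and "positive_measurable \<phi>2"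
    and "\<phi>1 \<in> G_class \<Phi> w"
    and "\<exists>C>0. \<forall>x. \<forall>r>0. \<phi>1 x r \<le> C * \<phi>2 x r"
    and "calderon_zygmund T K" and "genuine_kernel K"
    and "CZ_bounded_morrey T K \<Phi> w \<phi>1 \<phi>2"
  shows "\<exists>C>0. \<forall>x. \<forall>r>0.
           (\<integral>\<^sup>+t\<in>{r<..}. ennreal (\<phi>1 x t / t) \<partial>lebesgue) \<le> ennreal (C * \<phi>2 x r)"
proof -
  obtain q where q: "1 \<le> q" "w \<in> A_real q"
    using Muckenhoupt_A_imp_A_real[OF assms(2)] .
  interpret orlicz_weight \<Phi> w
    by unfold_locales (use assms(1) A_real_weight[OF q(2)] A_real_wmeas_ball_pos[OF q(2,1)] in auto)
  obtain \<sigma> where \<sigma>: "0 < \<sigma>" "\<sigma> < 1"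
    and reverse: "\<And>a r. 0 < r \<Longrightarrow> wmeas w (ball a r) \<le> ennreal \<sigma> * wmeas w (ball a (2 * r))"
    using A_real_reverse_doubling[OF q(2,1)] by blast
  obtain C1 where C1: "0 < C1" and \<phi>1_pos: "\<And>a r. 0 < r \<Longrightarrow> 0 < \<phi>1 a r"
    and dec: "\<And>a r a0 r0. 0 < r \<Longrightarrow> r \<le> r0 \<Longrightarrow> \<phi>1 a0 r0 \<le> C1 * \<phi>1 a r"
    and inc: "\<And>a r a0 r0. 0 < r0 \<Longrightarrow> r0 \<le> r \<Longrightarrow>
      ennreal (\<phi>1 a0 r0) / young_inv \<Phi> (inverse (wmeas w (ball a0 r0))) \<le>
      ennreal C1 * (ennreal (\<phi>1 a r) / young_inv \<Phi> (inverse (wmeas w (ball a r))))"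
    using assms(5) unfolding G_class_def by (auto dest: order.strict_trans2)
  define \<psi> where "\<psi> = radial_inf \<phi>1"
  have \<psi>: "\<psi> r \<le> \<phi>1 a r" "\<phi>1 a r \<le> C1 * \<psi> r" "0 < \<psi> r" "r \<le> s \<Longrightarrow> \<psi> s \<le> \<psi> r"
    if "0 < r" for a r s
    unfolding \<psi>_def using radial_inf_bounds[where \<phi> = \<phi>1 and C = C1 and r = r] \<phi>1_pos C1 dec that by blast+
  \<comment> \<open>One factor \<open>C1\<close> is the growth constant of \<open>G_class\<close>,
    the other the price of replacing \<open>\<phi>1 a r\<close> by \<open>\<psi> r\<close> on the
    right-hand side.\<close>
  interpret orlicz_ball_growth \<Phi> w \<psi> "C1 * C1" \<sigma>
  proof
    fix s r :: real and a b :: "real^'n"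
    assume s: "0 < s" "s \<le> r"
    then have r: "0 < r" by simp
    have "ennreal (\<phi>1 b s / U b s) \<le> ennreal (C1 * (\<phi>1 a r / U a r))"
      using inc[OF s, of b a] U_pos[OF s(1), of b] U_pos[OF r, of a] \<phi>1_pos[OF s(1), of b]
        \<phi>1_pos[OF r, of a] C1
      by (simp add: ennreal_U[OF s(1), symmetric] ennreal_U[OF r, symmetric] divide_ennreal
          ennreal_mult'[symmetric])
    then have "\<phi>1 b s / U b s \<le> C1 * (\<phi>1 a r / U a r)"
      using C1 \<phi>1_pos[OF r, of a] U_pos[OF r, of a] by (subst (asm) ennreal_le_iff) auto
    moreover have "\<psi> s / U b s \<le> \<phi>1 b s / U b s"
      using \<psi>(1)[OF s(1), where a = b] U_pos[OF s(1), of b] by (intro divide_right_mono) auto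
    moreover have "C1 * (\<phi>1 a r / U a r) \<le> C1 * (C1 * \<psi> r / U a r)"
      using \<psi>(2)[OF r, where a = a] U_pos[OF r, of a] C1 by (intro mult_left_mono divide_right_mono) auto
    ultimately show "\<psi> s / U b s \<le> C1 * C1 * (\<psi> r / U a r)"
      by simp
  qed (use \<sigma> C1 reverse \<psi>(3,4) in auto)
  have \<phi>2_pos: "0 < \<phi>2 a R" if "0 < R" for a R
    using assms(4) that by (simp add: positive_measurable_def)
  obtain A \<delta> where A: "0 < A" and \<delta>: "0 < \<delta>" "\<delta> \<le> 1"
    and sum: "\<And>x r N. 0 < r \<Longrightarrow> (\<Sum>k<N. \<psi> (2 ^ Suc k * r)) \<le> A * \<phi>2 x (\<delta> * r)"
    using dyadic_sum_bound[OF assms(7,8,9) \<psi>(1) \<phi>2_pos] by blast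
  obtain C2 where C2: "0 < C2" "\<And>x r. 0 < r \<Longrightarrow> \<phi>1 x r \<le> C2 * \<phi>2 x r"
    using assms(6) by blast
  show ?thesis
  \<comment> \<open>The first summand pays for radii between \<open>s\<close> and
    \<open>2 * s / \<delta>\<close>, the second for the dyadic intervals beyond; the common
    \<open>C1\<close> comes from replacing \<open>\<phi>1\<close> by \<open>\<psi>\<close>.\<close>
  proof (intro exI[of _ "C1 * C2 * (2 / \<delta>) + C1 * A"] conjI allI impI)
    show "0 < C1 * C2 * (2 / \<delta>) + C1 * A"
      using C1 C2(1) A \<delta> by (intro add_pos_pos mult_pos_pos divide_pos_pos) auto
    fix x :: "real^'n" and s :: real
    assume s: "0 < s"
    \<comment> \<open>The dyadic sum starting from \<open>r\<close> is bounded by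
      \<open>\<phi>2\<close> at \<open>\<delta> * r\<close>, which is now the prescribed radius
      \<open>s\<close>.\<close>
    define r where "r = s / \<delta>"
    have r: "0 < r" "s \<le> r" "\<delta> * r = s" "2 * r / s = 2 / \<delta>"
      using s \<delta> by (auto simp: r_def field_simps)
    have "(\<integral>\<^sup>+t\<in>{s<..}. ennreal (\<phi>1 x t / t) \<partial>lebesgue) \<le>
        (\<integral>\<^sup>+t\<in>{s<..}. ennreal (C1 * \<psi> t / t) \<partial>lebesgue)"
      using s \<psi>(2)[where a = x]
      by (intro nn_integral_mono) (auto simp: indicator_def intro!: ennreal_leI divide_right_mono)
    also have "\<dots> \<le> ennreal (C1 * \<psi> s * (2 * r / s) + C1 * (A * \<phi>2 x s))"
    proof (rule nn_integral_dyadic_le[OF s r(2)])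
      show "(\<Sum>k<N. C1 * \<psi> (2 ^ Suc k * r)) \<le> C1 * (A * \<phi>2 x s)" for N
        using mult_left_mono[OF sum[OF r(1), of N x], of C1] C1 r(3) by (simp add: sum_distrib_left)
    qed (use C1 \<psi>(3,4) in \<open>auto intro: less_imp_le\<close>)
    also have "\<dots> \<le> ennreal ((C1 * C2 * (2 / \<delta>) + C1 * A) * \<phi>2 x s)"
    proof (rule ennreal_leI)
      have "\<psi> s \<le> C2 * \<phi>2 x s"
        using \<psi>(1)[OF s, where a = x] C2(2)[OF s, of x] by linarith
      then have "C1 * \<psi> s * (2 / \<delta>) \<le> C1 * (C2 * \<phi>2 x s) * (2 / \<delta>)"
        using C1 \<delta> by (intro mult_right_mono mult_left_mono) auto
      then show "C1 * \<psi> s * (2 * r / s) + C1 * (A * \<phi>2 x s) \<le> (C1 * C2 * (2 / \<delta>) + C1 * A) * \<phi>2 x s"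
        unfolding r(4) by (simp add: algebra_simps)
    qed
    finally show "(\<integral>\<^sup>+t\<in>{s<..}. ennreal (\<phi>1 x t / t) \<partial>lebesgue) \<le>
        ennreal ((C1 * C2 * (2 / \<delta>) + C1 * A) * \<phi>2 x s)" .
  qed
qed

end
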